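(* There exists a finitely generated branch group (acting on a regular rooted tree $X^\ast$ with $X$ a finite set, $|X|\ge 2$) that is contained in $\mathcal{MF}$ and is not just-insoluble.
   Context: $\mathcal{MF}$ is the class of groups all of whose maximal subgroups have finite index. A group is just-insoluble if it is insoluble but every proper quotient (quotient by a non-trivial normal subgroup) is soluble. For a finite set $X$, $X^\ast$ is the rooted tree of finite words over $X$ (root the empty word; $u$ is joined to $ux$ for $x\in X$), and $\mathrm{Aut}(X^\ast)$ is its group of automorphisms. The $n$-th layer is the set $X^n$ of words of length $n$. A subgroup $G\le\mathrm{Aut}(X^\ast)$ is spherically transitive if it acts transitively on $X^n$ for every $n$. The rigid vertex stabiliser $\mathrm{rist}_G(v)$ of a vertex $v$ is the subgroup of all elements of $G$ that fix every vertex outside the subtree $vX^\ast$; $\mathrm{Rist}_G(n)$ is the product of all $\mathrm{rist}_G(v)$ with $v\in X^n$. A spherically transitive group $G$ is a branch group if $\mathrm{Rist}_G(n)$ has finite index in $G$ for every $n\in\mathbb{N}$. *)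

theory Defs
  imports "HOL-Algebra.Solvable_Groups" "HOL-Algebra.Bij"
begin

section \<open>Abstract groups\<close>

definition finitely_generated :: "('a, 'b) monoid_scheme \<Rightarrow> bool" where
  "finitely_generated G \<longleftrightarrow>
     group G \<and> (\<exists>S. finite S \<and> S \<subseteq> carrier G \<and> generate G S = carrier G)"

definition finite_index :: "'a set \<Rightarrow> ('a, 'b) monoid_scheme \<Rightarrow> bool" where
  "finite_index H G \<longleftrightarrow> subgroup H G \<and> finite (rcosets\<^bsub>G\<^esub> H)"

definition maximal_subgroup :: "'a set \<Rightarrow> ('a, 'b) monoid_scheme \<Rightarrow> bool" where
  "maximal_subgroup M G \<longleftrightarrow>
     subgroup M G \<and> M \<noteq> carrier G \<and>
     (\<forall>K. subgroup K G \<longrightarrow> M \<subseteq> K \<longrightarrow> K = M \<or> K = carrier G)"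

definition in_MF :: "('a, 'b) monoid_scheme \<Rightarrow> bool" where
  "in_MF G \<longleftrightarrow> group G \<and> (\<forall>M. maximal_subgroup M G \<longrightarrow> finite_index M G)"

definition just_insoluble :: "('a, 'b) monoid_scheme \<Rightarrow> bool" where
  "just_insoluble G \<longleftrightarrow>
     group G \<and> \<not> solvable G \<and>
     (\<forall>N. N \<lhd> G \<longrightarrow> N \<noteq> {\<one>\<^bsub>G\<^esub>} \<longrightarrow> solvable (G Mod N))"


section \<open>Regular rooted trees and their automorphisms\<close>

text \<open>The vertex set of the tree over the alphabet \<open>X\<close> is \<^term>\<open>lists X\<close>.\<close>

definition tree_adj :: "'x set \<Rightarrow> 'x list \<Rightarrow> 'x list \<Rightarrow> bool" where
  "tree_adj X u v \<longleftrightarrow>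
     u \<in> lists X \<and> v \<in> lists X \<and> (\<exists>x\<in>X. v = u @ [x] \<or> u = v @ [x])"

definition layer :: "'x set \<Rightarrow> nat \<Rightarrow> 'x list set" where
  "layer X n = {w \<in> lists X. length w = n}"

definition subtree :: "'x set \<Rightarrow> 'x list \<Rightarrow> 'x list set" where
  "subtree X v = {v @ w | w. w \<in> lists X}"

definition tree_auts :: "'x set \<Rightarrow> ('x list \<Rightarrow> 'x list) set" where
  "tree_auts X =
     {f \<in> Bij (lists X). f [] = [] \<and>
        (\<forall>u\<in>lists X. \<forall>v\<in>lists X. tree_adj X (f u) (f v) \<longleftrightarrow> tree_adj X u v)}"

definition Aut_tree :: "'x set \<Rightarrow> ('x list \<Rightarrow> 'x list) monoid" where
  "Aut_tree X = (BijGroup (lists X))\<lparr>carrier := tree_auts X\<rparr>"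

lemma subgroup_tree_auts: "subgroup (tree_auts X) (BijGroup (lists X))"
proof (rule group.subgroupI[OF group_BijGroup])
  show "tree_auts X \<subseteq> carrier (BijGroup (lists X))"
    by (auto simp: tree_auts_def BijGroup_def)
  have "(\<lambda>x\<in>lists X. x) \<in> tree_auts X"
    by (simp add: tree_auts_def id_Bij)
  then show "tree_auts X \<noteq> {}" by blast
next
  fix f assume f: "f \<in> tree_auts X"
  then have fB: "f \<in> Bij (lists X)" and f0: "f [] = []"
    and fa: "\<And>u v. u \<in> lists X \<Longrightarrow> v \<in> lists X \<Longrightarrow> tree_adj X (f u) (f v) \<longleftrightarrow> tree_adj X u v"
    by (auto simp: tree_auts_def)
  let ?g = "inv_into (lists X) f"
  have bij: "bij_betw f (lists X) (lists X)" using fB by (simp add: Bij_def)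
  have gm: "\<And>u. u \<in> lists X \<Longrightarrow> ?g u \<in> lists X"
    using fB by (rule Bij_inv_into_mem)
  have fg: "\<And>u. u \<in> lists X \<Longrightarrow> f (?g u) = u"
    using bij by (simp add: bij_betw_inv_into_right)
  have g0: "?g [] = []"
    using bij_betw_inv_into_left[OF bij, of "[]"] f0 by simp
  have "restrict ?g (lists X) \<in> tree_auts X"
    unfolding tree_auts_def
    using restrict_inv_into_Bij[OF fB] g0 gm fg fa[OF gm gm] by simp
  then show "inv\<^bsub>BijGroup (lists X)\<^esub> f \<in> tree_auts X"
    using inv_BijGroup[OF fB] by simp
next
  fix f g assume "f \<in> tree_auts X" "g \<in> tree_auts X"
  moreover from this have "\<And>u. u \<in> lists X \<Longrightarrow> g u \<in> lists X"
    using Bij_imp_funcset unfolding tree_auts_def by blast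
  ultimately show "f \<otimes>\<^bsub>BijGroup (lists X)\<^esub> g \<in> tree_auts X"
    by (simp add: tree_auts_def BijGroup_def compose_Bij) (simp add: compose_def)
qed

lemma group_Aut_tree: "group (Aut_tree X)"
  unfolding Aut_tree_def
  by (rule group.subgroup_imp_group[OF group_BijGroup subgroup_tree_auts])


section \<open>Branch groups\<close>

text \<open>A group acting on the tree is given by its underlying set \<open>G\<close> of automorphisms;
  the corresponding group structure is \<open>Aut_tree X\<lparr>carrier := G\<rparr>\<close>.\<close>

definition spherically_transitive :: "'x set \<Rightarrow> ('x list \<Rightarrow> 'x list) set \<Rightarrow> bool" where
  "spherically_transitive X G \<longleftrightarrow>
     (\<forall>n. \<forall>u\<in>layer X n. \<forall>v\<in>layer X n. \<exists>g\<in>G. g u = v)"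

definition rist :: "'x set \<Rightarrow> ('x list \<Rightarrow> 'x list) set \<Rightarrow> 'x list \<Rightarrow> ('x list \<Rightarrow> 'x list) set" where
  "rist X G v = {g \<in> G. \<forall>u \<in> lists X - subtree X v. g u = u}"

text \<open>The rigid stabilisers of distinct vertices of one layer commute elementwise
  (\<open>rist_commute\<close> below), so their product is the subgroup that they generate.\<close>

definition Rist :: "'x set \<Rightarrow> ('x list \<Rightarrow> 'x list) set \<Rightarrow> nat \<Rightarrow> ('x list \<Rightarrow> 'x list) set" where
  "Rist X G n = generate (Aut_tree X) (\<Union>v\<in>layer X n. rist X G v)"

definition branch_group :: "'x set \<Rightarrow> ('x list \<Rightarrow> 'x list) set \<Rightarrow> bool" where
  "branch_group X G \<longleftrightarrow>
     subgroup G (Aut_tree X) \<and> spherically_transitive X G \<and>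
     (\<forall>n. finite_index (Rist X G n) (Aut_tree X\<lparr>carrier := G\<rparr>))"

lemma rist_commute:
  assumes G: "subgroup G (Aut_tree X)"
    and v: "v \<in> layer X n" and w: "w \<in> layer X n" and "v \<noteq> w"
    and g: "g \<in> rist X G v" and h: "h \<in> rist X G w"
  shows "g \<otimes>\<^bsub>Aut_tree X\<^esub> h = h \<otimes>\<^bsub>Aut_tree X\<^esub> g"
proof -
  have B: "a \<in> Bij (lists X)" if "a \<in> G" for a
    using subgroup.subset[OF G] that by (auto simp: Aut_tree_def tree_auts_def)
  have stable: "a u \<in> subtree X z"
    if a: "a \<in> rist X G z" and u: "u \<in> subtree X z" "u \<in> lists X" for a u z
  proof (rule ccontr)
    assume n: "a u \<notin> subtree X z"
    have aB: "a \<in> Bij (lists X)" using a B by (auto simp: rist_def)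
    then have m: "a u \<in> lists X" using u Bij_imp_funcset by blast
    with n a have "a (a u) = a u" by (auto simp: rist_def)
    then have "a u = u" using aB m u by (auto simp: Bij_def bij_betw_def dest: inj_onD)
    with n u show False by simp
  qed
  have disj: "subtree X v \<inter> subtree X w = {}"
    using v w \<open>v \<noteq> w\<close> by (auto simp: subtree_def layer_def)
  have gB: "g \<in> Bij (lists X)" and hB: "h \<in> Bij (lists X)"
    using g h B by (auto simp: rist_def)
  have "g (h u) = h (g u)" if u: "u \<in> lists X" for u
  proof -
    have m: "g u \<in> lists X" "h u \<in> lists X"
      using u gB hB Bij_imp_funcset by blast+
    have gf: "g x = x" if "x \<in> lists X" "x \<notin> subtree X v" for x
      using g that by (auto simp: rist_def)
    have hf: "h x = x" if "x \<in> lists X" "x \<notin> subtree X w" for x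
      using h that by (auto simp: rist_def)
    consider "u \<in> subtree X v" "u \<notin> subtree X w" | "u \<in> subtree X w" "u \<notin> subtree X v"
      | "u \<notin> subtree X v" "u \<notin> subtree X w" using disj by blast
    then show ?thesis
    proof cases
      case 1
      then have "g u \<notin> subtree X w" using stable[OF g] u disj by blast
      with 1 show ?thesis using hf u m by simp
    next
      case 2
      then have "h u \<notin> subtree X v" using stable[OF h] u disj by blast
      with 2 show ?thesis using gf u m by simp
    next
      case 3
      then show ?thesis using gf hf u by simp
    qed
  qed
  then show ?thesis
    using gB hB by (simp add: Aut_tree_def BijGroup_def compose_def fun_eq_iff restrict_def)
qed

end

theory Submission
  imports Defs "HOL-Algebra.Sym_Groups" "HOL-Library.Numeral_Type"
begin

text \<open>The group is a wreath product \<open>GGS wr Sym(7)\<close> acting on the tree of words over seven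
letters, with the symmetric group permuting the seven subtrees below the root and a copy of a
periodic Gupta--Sidki type group \<open>GGS\<close> acting in each of them. Its action on the first layer is
the insoluble group \<open>Sym(7)\<close>, and the kernel of that action is not trivial; so the wreath product has
an insoluble proper quotient and is not just-insoluble. All the work lies in the maximal subgroups.

\<open>GGS\<close> is generated by the rotations \<open>rot c\<close> of the letters, which are the integers modulo 7, and by
the directed automorphisms \<open>dir c = (dir c, rot c, rot (- c), 0, 0, 0, 0)\<close>, written by their
sections at the seven letters. Its commutator subgroup \<open>GGS_comm\<close> is the common kernel of two
invariants with values modulo 7, the rotation at the root and the exponent sum of the directed
generators. Since \<open>dir c\<close> lives on three consecutive letters out of seven, there are two elements of
\<open>GGS_comm\<close> whose supports meet in a single letter, where their sections are generators; hence
the second derived subgroup already contains a copy of \<open>GGS_comm\<close> below every letter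
(\<open>commutators_of_comm\<close>). By the usual commutator argument every non-trivial normal subgroup of \<open>GGS\<close>
then contains the product \<open>level_comm n\<close> of the copies of \<open>GGS_comm\<close> at the vertices of some layer
\<open>n\<close> (\<open>nontrivial_normal_contains_level\<close>). These products have finite index, which gives the
branch property.

A maximal subgroup of the wreath product either contains some \<open>level_comm (n + 1)\<close>, and then has
finite index, or it is dense: together with each \<open>level_comm (n + 1)\<close> it generates everything.
It remains to see that a dense subgroup \<open>H\<close> is the whole group, first in \<open>GGS\<close> and then in the wreath
product.

Going down the tree: density passes to the groups of sections of \<open>H\<close>. By density \<open>H\<close> contains an element
with non-zero exponent sum. Passing to sections never lengthens words and usually shortens them, and because the exponents
\<open>1, -1\<close> in \<open>dir\<close> add up to zero, an element that rotates the letters has a seventh power whose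
sections do not. After finitely many steps some iterated section group contains a non-trivial power of
\<open>dir 1\<close>, then also a conjugate of the rotations, and a second induction on length removes the
conjugating element (\<open>descends_of_dexp\<close>, \<open>descends_of_dir\<close>, \<open>descends_of_conjugate\<close>). So some iterated
section group is all of \<open>GGS\<close>.

Going up the tree: suppose that the elements of \<open>H\<close> fixing the first layer have all of \<open>GGS\<close> as sections at each
letter, while \<open>H\<close> is dense. For two letters \<open>x, z\<close> density provides an element of \<open>H\<close> with trivial
section at \<open>z\<close> and non-trivial section at \<open>x\<close>. Non-trivial normal subgroups of \<open>GGS\<close> do not
commute, so iterated commutators of such elements give a non-trivial element of \<open>H\<close> that is supported below
\<open>x\<close> alone. The elements of \<open>H\<close> supported below \<open>x\<close> form a non-trivial normal subgroup of \<open>GGS\<close>, hence contain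
some \<open>level_comm n\<close>; so \<open>H\<close> contains \<open>level_comm (n + 1)\<close> for large \<open>n\<close>, and by density
\<open>H\<close> is everything (\<open>dense_full_sections\<close>).\<close>

section \<open>Arithmetic modulo seven\<close>

lemma UNIV7: "(UNIV::7 set) = {0,1,2,3,4,5,6}"
proof -
  have "x \<in> {0,1,2,3,4,5,6}" for x :: 7
  proof (cases x rule: bit1.cases)
    case (1 z)
    then have "0 \<le> z" "z < 7" by simp_all
    then have "z=0\<or>z=1\<or>z=2\<or>z=3\<or>z=4\<or>z=5\<or>z=6" by presburger
    then show ?thesis using 1(1) by auto
  qed
  then show ?thesis by blast
qed

lemma all7: "(\<forall>x::7. P x) \<longleftrightarrow> P 0 \<and> P 1 \<and> P 2 \<and> P 3 \<and> P 4 \<and> P 5 \<and> P 6"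
proof -
  have "(\<forall>x. P x) \<longleftrightarrow> (\<forall>x\<in>UNIV. P x)" by blast
  then show ?thesis unfolding UNIV7 by (simp only: ball_simps simp_thms)
qed

lemma sum7: "(\<Sum>x\<in>(UNIV::7 set). f x) = f 0 + f 1 + f 2 + f 3 + f 4 + f 5 + f 6"
  for f :: "7 \<Rightarrow> 'a::comm_monoid_add"
  unfolding UNIV7 by (subst sum.insert, simp, simp)+ (simp add: add.assoc)

lemma invertible7: "c \<noteq> 0 \<Longrightarrow> \<exists>k. k * c = 1" for c :: 7
proof -
  have "\<forall>c::7. (c = 0 \<or> (\<exists>k. k * c = 1))"
    unfolding all7
    apply (intro conjI)
    subgoal by simp
    subgoal by (intro disjI2 exI[of _ 1]) simp
    subgoal by (intro disjI2 exI[of _ 4]) simp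
    subgoal by (intro disjI2 exI[of _ 5]) simp
    subgoal by (intro disjI2 exI[of _ 2]) simp
    subgoal by (intro disjI2 exI[of _ 3]) simp
    subgoal by (intro disjI2 exI[of _ 6]) simp
    done
  then show "c \<noteq> 0 \<Longrightarrow> ?thesis" by blast
qed

lemma of_nat7: "\<exists>m. x = of_nat m" for x :: 7
proof -
  have "\<forall>x::7. \<exists>m. x = of_nat m"
    unfolding all7
    by (metis of_nat_0 of_nat_1 of_nat_numeral)
  then show ?thesis by blast
qed

lemma generates7:
  fixes e d :: 7
  assumes "e \<noteq> 0" "e \<in> A" "0 \<in> A" "\<And>a b. a \<in> A \<Longrightarrow> b \<in> A \<Longrightarrow> a + b \<in> A"
  shows "d \<in> A"
proof -
  have m: "of_nat m * e \<in> A" for m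
    by (induction m) (simp_all add: assms distrib_right)
  obtain k where "k * e = 1" using invertible7[OF assms(1)] by blast
  then have "d = (d * k) * e" by (simp add: mult.assoc)
  then show ?thesis using m of_nat7[of "d * k"] by metis
qed

lemma sum_multiples7:
  fixes f :: "7 \<Rightarrow> 'a::comm_monoid_add"
  assumes "c \<noteq> 0" shows "(\<Sum>j<7. f (of_nat j * c)) = (\<Sum>x\<in>UNIV. f x)"
proof -
  have s: "{..<7::nat} = {0,1,2,3,4,5,6}" by auto
  have "(\<Sum>j<7. g (of_nat j)) = (\<Sum>x\<in>UNIV. g x)" for g :: "7 \<Rightarrow> 'a"
    unfolding s sum7 by (simp add: add.assoc)
  from this[of "\<lambda>x. f (x * c)"]
  have "(\<Sum>j<7. f (of_nat j * c)) = (\<Sum>x\<in>UNIV. f (x * c))" .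
  also obtain k where k: "k * c = 1" using invertible7[OF assms] by blast
  have "(\<Sum>x\<in>UNIV. f (x * c)) = (\<Sum>x\<in>UNIV. f x)"
    by (rule sum.reindex_bij_witness[of _ "\<lambda>y. y * k" "\<lambda>x. x * c"])
      (simp_all add: mult.assoc k mult.commute[of c k])
  finally show ?thesis .
qed

lemma sum_shift7: "(\<Sum>y\<in>UNIV. f (y + s)) = (\<Sum>y\<in>UNIV. f y)" for f :: "7 \<Rightarrow> 'a::comm_monoid_add"
  by (rule sum.reindex_bij_witness[of _ "\<lambda>y. y - s" "\<lambda>y. y + s"]) auto

section \<open>Automorphisms of a rooted tree\<close>

text \<open>Automorphisms are modelled on all words over a letter type, so that no side conditions about the
alphabet arise. Preservation of lengths and of prefixes is the same as preservation of the root and of adjacency.\<close>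
definition tree_bij :: "('x list \<Rightarrow> 'x list) \<Rightarrow> bool" where
  "tree_bij f \<longleftrightarrow> bij f \<and> (\<forall>w. length (f w) = length w) \<and>
     (\<forall>u w. take (length u) (f (u @ w)) = f u)"

typedef 'x taut = "{f :: 'x list \<Rightarrow> 'x list. tree_bij f}"
  morphisms act Abs_taut
  by (rule exI[of _ id]) (simp add: tree_bij_def)

lemma tree_bij_act: "tree_bij (act g)"
  using act by blast

lemma bij_act: "bij (act g)"
  and length_act [simp]: "length (act g w) = length w"
  and take_act: "take (length u) (act g (u @ w)) = act g u"
  using tree_bij_act[of g] by (auto simp: tree_bij_def)

lemma act_Abs: "tree_bij f \<Longrightarrow> act (Abs_taut f) = f"
  by (simp add: Abs_taut_inverse)

lemma taut_eqI: "(\<And>w. act g w = act h w) \<Longrightarrow> g = h"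
  by (metis act_inject ext)

lemma act_inj [simp]: "act g u = act g v \<longleftrightarrow> u = v"
  using bij_act[of g] by (auto dest: bij_is_inj injD)

lemma act_Nil [simp]: "act g [] = []"
  by (simp flip: length_0_conv)

lemma tree_bij_comp: "tree_bij f \<Longrightarrow> tree_bij g \<Longrightarrow> tree_bij (f \<circ> g)"
  unfolding tree_bij_def by (smt (verit) append_take_drop_id bij_comp comp_apply)

lemma tree_bij_inv:
  assumes "tree_bij f" shows "tree_bij (inv_into UNIV f)"
proof -
  have f: "bij f" "\<And>w. length (f w) = length w" "\<And>u w. take (length u) (f (u @ w)) = f u"
    using assms by (auto simp: tree_bij_def)
  have ff: "f (inv_into UNIV f w) = w" for w using f(1) by (simp add: bij_is_surj surj_f_inv_f)
  have len: "length (inv_into UNIV f w) = length w" for w by (metis f(2) ff)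
  have "take (length u) (inv_into UNIV f (u @ w)) = inv_into UNIV f u" for u w
  proof -
    let ?y = "inv_into UNIV f (u @ w)"
    have "f (take (length u) ?y) = take (length u) (f ?y)"
      using f(3)[of "take (length u) ?y" "drop (length u) ?y"] len[of "u @ w"] by simp
    also have "\<dots> = u" by (simp add: ff)
    finally show ?thesis by (metis f(1) bij_inv_eq_iff)
  qed
  then show ?thesis using f(1) len by (simp add: tree_bij_def bij_imp_bij_inv)
qed

text \<open>The group is written additively because \<^class>\<open>group_add\<close> does not presuppose commutativity: \<open>g + h\<close> is
\<open>h\<close> followed by \<open>g\<close>, and \<open>g + h - g\<close> is a conjugate of \<open>h\<close>.\<close>
instantiation taut :: (type) group_add
begin
definition "0 = Abs_taut (id :: 'a list \<Rightarrow> 'a list)"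
definition "g + h = Abs_taut (act g \<circ> act h)"
definition "- g = Abs_taut (inv_into UNIV (act g))"
definition "g - h = g + - (h :: 'a taut)"

lemma act_zero [simp]: "act 0 w = w"
  by (simp add: zero_taut_def act_Abs tree_bij_def)

lemma act_plus [simp]: "act (g + h) w = act g (act h w)"
  by (simp add: plus_taut_def act_Abs tree_bij_comp tree_bij_act)

lemma act_uminus: "act (- g) w = inv_into UNIV (act g) w"
  by (simp add: uminus_taut_def act_Abs tree_bij_inv tree_bij_act)

instance
proof
  fix a b c :: "'a taut"
  show "a + b + c = a + (b + c)" by (rule taut_eqI) simp
  show "0 + a = a" by (rule taut_eqI) simp
  show "a + 0 = a" by (rule taut_eqI) simp
  show "- a + a = 0"
    by (rule taut_eqI) (simp add: act_uminus bij_is_inj[OF bij_act])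
  show "a + - b = a - b" by (simp add: minus_taut_def)
qed
end

lemma act_act_uminus [simp]: "act g (act (- g) w) = w" "act (- g) (act g w) = w"
  by (simp_all flip: act_plus)

lemma act_uminus_iff: "act (- g) u = v \<longleftrightarrow> act g v = u"
  by auto

definition sec :: "'x taut \<Rightarrow> 'x list \<Rightarrow> 'x taut" where
  "sec g u = Abs_taut (\<lambda>w. drop (length u) (act g (u @ w)))"

lemma act_append': "act g (u @ w) = act g u @ drop (length u) (act g (u @ w))"
  by (metis append_take_drop_id take_act)

lemma act_sec: "act (sec g u) w = drop (length u) (act g (u @ w))"
proof -
  have "tree_bij (\<lambda>w. drop (length u) (act g (u @ w)))"
    unfolding tree_bij_def
  proof (intro conjI allI)
    show "bij (\<lambda>w. drop (length u) (act g (u @ w)))"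
    proof (rule bijI)
      show "inj (\<lambda>w. drop (length u) (act g (u @ w)))"
        by (rule injI) (metis act_append' act_inj same_append_eq)
      have "\<exists>v. w = drop (length u) (act g (u @ v))" for w
      proof -
        let ?z = "act (- g) (act g u @ w)"
        have "take (length u) ?z = u"
          using take_act[of "act g u" "- g" w] by simp
        then have "act g (u @ drop (length u) ?z) = act g u @ w"
          by (metis act_act_uminus(1) append_take_drop_id)
        then show ?thesis by (metis append_eq_conv_conj length_act)
      qed
      then show "surj (\<lambda>w. drop (length u) (act g (u @ w)))" by blast
    qed
    show "length (drop (length u) (act g (u @ w))) = length w" for w by simp
    show "take (length v) (drop (length u) (act g (u @ v @ w))) = drop (length u) (act g (u @ v))"
      for v w using take_act[of "u @ v" g w] by (simp add: take_drop add.commute flip: drop_take)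
  qed
  then show ?thesis by (simp add: sec_def act_Abs)
qed

lemma act_append: "act g (u @ w) = act g u @ act (sec g u) w"
  by (metis act_append' act_sec)

lemma act_Cons: "act g (x # w) = act g [x] @ act (sec g [x]) w"
  using act_append[of g "[x]" w] by simp

lemma sec_eqI: "(\<And>w. act g (u @ w) = act g u @ act h w) \<Longrightarrow> sec g u = h"
  by (rule taut_eqI) (metis act_append same_append_eq)

lemma sec_Nil [simp]: "sec g [] = g"
  by (rule sec_eqI) simp

lemma sec_append: "sec g (u @ v) = sec (sec g u) v"
  by (rule sec_eqI) (simp add: act_append)

lemma sec_zero [simp]: "sec 0 u = 0"
  by (rule sec_eqI) simp

lemma sec_plus [simp]: "sec (g + h) u = sec g (act h u) + sec h u"
  by (rule sec_eqI, unfold act_plus, unfold act_append, rule refl)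

lemma sec_uminus: "sec (- g) u = - sec g (act (- g) u)"
proof -
  have "sec (g + - g) u = 0" by simp
  then show ?thesis unfolding sec_plus by (metis minus_unique add.inverse_inverse)
qed

lemma sec_uminus_fix: "act g u = u \<Longrightarrow> sec (- g) u = - sec g u"
  by (metis act_uminus_iff sec_uminus)

lemma sec_conj: "sec (g + h - g) (act g u) = sec g (act h u) + sec h u - sec g u"
  by (simp only: diff_conv_add_uminus sec_plus sec_uminus act_plus act_act_uminus)

lemma act_fix_uminus: "act g u = u \<Longrightarrow> act (- g) u = u"
  by (simp add: act_uminus_iff)

fun node_fun :: "('x \<Rightarrow> 'x) \<Rightarrow> ('x \<Rightarrow> 'x taut) \<Rightarrow> 'x list \<Rightarrow> 'x list" where
  "node_fun s F [] = []"
| "node_fun s F (x # w) = s x # act (F x) w"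

definition node :: "('x \<Rightarrow> 'x) \<Rightarrow> ('x \<Rightarrow> 'x taut) \<Rightarrow> 'x taut" where
  "node s F = Abs_taut (node_fun s F)"

lemma tree_bij_node:
  assumes "bij s" shows "tree_bij (node_fun s F)"
  unfolding tree_bij_def
proof (intro conjI allI)
  show "bij (node_fun s F)"
  proof (rule bijI)
    show "inj (node_fun s F)"
    proof (rule injI)
      fix u v assume "node_fun s F u = node_fun s F v"
      then show "u = v" using assms by (cases u; cases v) (auto simp: bij_is_inj inj_eq)
    qed
    have "\<exists>v. w = node_fun s F v" for w
    proof (cases w)
      case Nil then show ?thesis by (intro exI[of _ "[]"]) simp
    next
      case (Cons y v)
      then show ?thesis using assms
        by (intro exI[of _ "inv_into UNIV s y # act (- F (inv_into UNIV s y)) v"]) (simp add: bij_is_surj surj_f_inv_f)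
    qed
    then show "surj (node_fun s F)" by blast
  qed
  show "length (node_fun s F w) = length w" for w by (cases w) auto
  show "take (length u) (node_fun s F (u @ w)) = node_fun s F u" for u w
    by (cases u) (auto simp: take_act)
qed

lemma act_node: "bij s \<Longrightarrow> act (node s F) (x # w) = s x # act (F x) w"
  by (simp add: node_def act_Abs tree_bij_node)

lemma sec_node: "bij s \<Longrightarrow> sec (node s F) [x] = F x"
  by (rule sec_eqI) (simp add: act_node)

lemma level_one_eqI:
  assumes "\<And>x. act g [x] = act h [x]" "\<And>x. sec g [x] = sec h [x]"
  shows "g = h"
proof (rule taut_eqI)
  show "act g w = act h w" for w
  proof (cases w)
    case (Cons x v)
    then show ?thesis using act_Cons[of g x v] act_Cons[of h x v] assms[of x] by simp
  qed simp
qed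

primrec at_vertex :: "'x list \<Rightarrow> 'x taut \<Rightarrow> 'x taut" where
  "at_vertex [] k = k"
| "at_vertex (x # w) k = node id (\<lambda>y. if y = x then at_vertex w k else 0)"

lemma act_vertex_Cons [simp]: "act (at_vertex (x # w) k) [y] = [y]"
  by (simp add: act_node)

lemma sec_vertex_Cons [simp]: "sec (at_vertex (x # w) k) [y] = (if y = x then at_vertex w k else 0)"
  by (simp add: sec_node)

declare at_vertex.simps(2) [simp del]

lemma act_vertex_self [simp]: "act (at_vertex w k) w = w"
proof (induction w)
  case (Cons x w)
  then show ?case using act_Cons[of "at_vertex (x # w) k" x w] by simp
qed simp

lemma sec_vertex_self [simp]: "sec (at_vertex w k) w = k"
proof (induction w)
  case (Cons x w)
  have "sec (at_vertex (x # w) k) (x # w) = sec (sec (at_vertex (x # w) k) [x]) w"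
    using sec_append[of "at_vertex (x # w) k" "[x]" w] by simp
  then show ?case using Cons by simp
qed simp

lemma sec_vertex_neq:
  assumes "length u = length w" "u \<noteq> w"
  shows "act (at_vertex w k) u = u \<and> sec (at_vertex w k) u = 0"
  using assms
proof (induction u w rule: list_induct2)
  case (Cons x u y w)
  have "sec (at_vertex (y # w) k) (x # u) = sec (sec (at_vertex (y # w) k) [x]) u"
    using sec_append[of "at_vertex (y # w) k" "[x]" u] by simp
  moreover have "act (at_vertex (y # w) k) (x # u) = x # act (sec (at_vertex (y # w) k) [x]) u"
    by (simp add: act_Cons[of _ x u])
  ultimately show ?case using Cons by auto
qed simp

lemma level_eqI:
  assumes "\<And>u. length u = n \<Longrightarrow> act g u = act h u" "\<And>u. length u = n \<Longrightarrow> sec g u = sec h u"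
  shows "g = h"
proof (rule taut_eqI)
  show "act g w = act h w" for w
  proof (cases "n \<le> length w")
    case True
    then have l: "length (take n w) = n" by simp
    show ?thesis using act_append[of _ "take n w" "drop n w"] assms[OF l] by simp
  next
    case False
    let ?r = "w @ replicate (n - length w) undefined"
    have "length ?r = n" using False by simp
    then have "act g ?r = act h ?r" using assms by blast
    then show ?thesis by (metis take_act)
  qed
qed

lemma act_vertex_level: "length u = length w \<Longrightarrow> act (at_vertex w k) u = u"
  by (cases "u = w") (auto simp: sec_vertex_neq)

lemma act_vertex_outside: "(\<And>r. u \<noteq> w @ r) \<Longrightarrow> act (at_vertex w k) u = u"
proof (induction w arbitrary: u)
  case (Cons x w)
  show ?case
  proof (cases u)
    case u: (Cons y v)
    have "act (at_vertex w k) v = v" if "y = x"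
      by (rule Cons.IH) (use Cons.prems u that in auto)
    then show ?thesis using act_Cons[of "at_vertex (x # w) k" y v] u by simp
  qed simp
qed auto

lemma sec_vertex_level: "length u = length w \<Longrightarrow> sec (at_vertex w k) u = (if u = w then k else 0)"
  by (cases "u = w") (auto simp: sec_vertex_neq)

text \<open>Conjugation moves a copy at one vertex to a copy at another vertex of the same layer. Through this, an
element of a rigid stabiliser yields elements at every vertex of its layer.\<close>
lemma vertex_conj: "g + at_vertex w k - g = at_vertex (act g w) (sec g w + k - sec g w)"
proof (rule level_eqI[where n = "length w"])
  fix u :: "'a list" assume l: "length u = length w"
  let ?v = "act (- g) u"
  have v: "length ?v = length w" "u = act g ?v" using l by simp_all
  show "act (g + at_vertex w k - g) u = act (at_vertex (act g w) (sec g w + k - sec g w)) u"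
    using l by (simp only: diff_conv_add_uminus act_plus act_vertex_level v(1) length_act) simp
  show "sec (g + at_vertex w k - g) u = sec (at_vertex (act g w) (sec g w + k - sec g w)) u"
    using v(1) l sec_conj[of g "at_vertex w k" ?v]
    by (auto simp: act_vertex_level sec_vertex_level)
qed

lemma vertex_plus: "at_vertex w (k + l) = at_vertex w k + at_vertex w l"
  by (rule level_eqI[where n = "length w"]) (auto simp: act_vertex_level sec_vertex_level)

lemma vertex_zero [simp]: "at_vertex w 0 = 0"
  by (rule level_eqI[where n = "length w"]) (auto simp: act_vertex_level sec_vertex_level)

lemma vertex_uminus: "at_vertex w (- k) = - at_vertex w k"
  by (metis add.inverse_unique vertex_plus vertex_zero right_minus)

lemma vertex_append: "at_vertex (u @ v) k = at_vertex u (at_vertex v k)"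
  by (induction u) (simp_all add: at_vertex.simps(2) cong: if_cong)

section \<open>A Gupta--Sidki type group on seven letters\<close>

text \<open>Simplification with exactly these rules decides the word problem in free groups.\<close>
lemmas group_word = add.assoc minus_add diff_conv_add_uminus minus_minus add_minus_cancel
  minus_add_cancel left_minus right_minus add_0_left add_0_right minus_zero

definition is_subgroup :: "'a::group_add set \<Rightarrow> bool" where
  "is_subgroup S \<longleftrightarrow> 0 \<in> S \<and> (\<forall>a\<in>S. \<forall>b\<in>S. a + b \<in> S) \<and> (\<forall>a\<in>S. - a \<in> S)"

lemma is_subgroupD:
  assumes "is_subgroup S"
  shows "0 \<in> S" "a \<in> S \<Longrightarrow> b \<in> S \<Longrightarrow> a + b \<in> S" "a \<in> S \<Longrightarrow> - a \<in> S"
    "a \<in> S \<Longrightarrow> b \<in> S \<Longrightarrow> a - b \<in> S"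
  using assms unfolding is_subgroup_def by (blast, blast, blast, metis diff_conv_add_uminus)

lemma is_subgroupI:
  assumes "0 \<in> S" "\<And>a b. a \<in> S \<Longrightarrow> b \<in> S \<Longrightarrow> a + b \<in> S" "\<And>a. a \<in> S \<Longrightarrow> - a \<in> S"
  shows "is_subgroup S"
  using assms by (auto simp: is_subgroup_def)

definition normalised_by :: "'a::group_add set \<Rightarrow> 'a set \<Rightarrow> bool" where
  "normalised_by N G \<longleftrightarrow> (\<forall>g\<in>G. \<forall>k\<in>N. g + k - g \<in> N)"

lemma normalised_byD: "normalised_by N G \<Longrightarrow> g \<in> G \<Longrightarrow> k \<in> N \<Longrightarrow> g + k - g \<in> N"
  by (simp add: normalised_by_def)

definition rot :: "7 \<Rightarrow> 7 taut" where
  "rot c = node (\<lambda>x. x + c) (\<lambda>_. 0)"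

lemma bij_add7: "bij (\<lambda>x::7. x + c)"
  by (rule bij_betw_byWitness[where f' = "\<lambda>x. x - c"]) auto

lemma act_rot [simp]: "act (rot c) (x # w) = (x + c) # w"
  by (simp add: rot_def act_node bij_add7)

lemma sec_rot [simp]: "sec (rot c) [x] = 0"
  by (simp add: rot_def sec_node bij_add7)

text \<open>The recursion \<open>dir c = (dir c, rot c, rot (- c), 0, 0, 0, 0)\<close>. The rotations in it cancel in total, which
makes the group periodic and drives the contraction. The support of three consecutive letters is short enough
among seven for two combinations of neighbouring conjugates, each of support four, to meet in one letter only.\<close>
fun dir_fun :: "7 \<Rightarrow> 7 list \<Rightarrow> 7 list" where
  "dir_fun c [] = []"
| "dir_fun c (x # w) = x # (if x = 0 then dir_fun c w else if x = 1 then act (rot c) w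
     else if x = 2 then act (rot (- c)) w else w)"

definition dir :: "7 \<Rightarrow> 7 taut" where
  "dir c = Abs_taut (dir_fun c)"

lemma rot_plus: "rot (c + d) = rot c + rot d"
  by (rule level_one_eqI) (simp_all add: add.assoc add.commute[of c])

lemma rot_zero [simp]: "rot 0 = 0"
  by (rule level_one_eqI) simp_all

lemma rot_uminus: "rot (- c) = - rot c"
  by (metis add.inverse_unique right_minus rot_plus rot_zero)

lemma dir_fun_inverse: "dir_fun (- c) (dir_fun c w) = w"
  by (induction w) (simp_all add: rot_uminus)

lemma tree_bij_dir: "tree_bij (dir_fun c)"
  unfolding tree_bij_def
proof (intro conjI allI)
  show "bij (dir_fun c)"
    by (rule bij_betw_byWitness[where f' = "dir_fun (- c)"])
      (use dir_fun_inverse[of "- c"] in \<open>auto simp: dir_fun_inverse\<close>)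
  show "length (dir_fun c w) = length w" for w
    by (induction w) simp_all
  show "take (length u) (dir_fun c (u @ w)) = dir_fun c u" for u w
    by (induction u) (simp_all add: take_act)
qed

lemma act_dir_Cons: "act (dir c) (x # w) = x # (if x = 0 then act (dir c) w else if x = 1 then act (rot c) w
     else if x = 2 then act (rot (- c)) w else w)"
  by (simp add: dir_def act_Abs tree_bij_dir)

lemma act_dir [simp]: "act (dir c) [x] = [x]"
  by (simp add: act_dir_Cons)

lemma sec_dir [simp]: "sec (dir c) [x] = (if x = 0 then dir c else if x = 1 then rot c
     else if x = 2 then rot (- c) else 0)"
  by (rule sec_eqI) (simp add: act_dir_Cons)

lemma act_rot_rot: "act (rot c) (act (rot d) w) = act (rot (c + d)) w"
  by (simp add: rot_plus)

lemma dir_plus: "dir (c + d) = dir c + dir d"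
proof (rule taut_eqI)
  show "act (dir (c + d)) w = act (dir c + dir d) w" for w
    by (induction w) (simp_all add: act_dir_Cons act_rot_rot algebra_simps)
qed

lemma dir_zero [simp]: "dir 0 = 0"
proof -
  have "dir 0 + dir 0 = dir 0 + 0" using dir_plus[of 0 0] by simp
  then show ?thesis by (simp only: add_left_cancel)
qed

lemma dir_uminus: "dir (- c) = - dir c"
  by (metis add.inverse_unique right_minus dir_plus dir_zero)

definition root_shift :: "7 taut \<Rightarrow> 7" where
  "root_shift g = hd (act g [0])"

text \<open>A directed syllable \<open>dir c\<close> that acts below the letter \<open>i\<close> has the rotations \<open>c\<close> and \<open>- c\<close> as sections at the
letters \<open>i + 1\<close> and \<open>i + 2\<close> and so contributes \<open>- ((i + 1) * c - (i + 2) * c) = c\<close>. Reading the exponent sum off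
the first two layers shows that it does not depend on the word that represents the element.\<close>
definition dir_exp :: "7 taut \<Rightarrow> 7" where
  "dir_exp g = - (\<Sum>x\<in>UNIV. x * root_shift (sec g [x]))"

lemma root_shiftI: "(\<And>x. act g [x] = [x + s]) \<Longrightarrow> root_shift g = s"
  by (simp add: root_shift_def)

lemma shift_simps [simp]: "root_shift (rot c) = c" "root_shift (dir c) = 0" "root_shift 0 = 0"
  by (simp_all add: root_shift_def)

text \<open>The index \<open>n\<close> counts the directed syllables of one particular word, including cancelling ones; it is the
length used in all contraction arguments.\<close>
inductive word_rep :: "7 taut \<Rightarrow> 7 \<Rightarrow> nat \<Rightarrow> bool" where
  word_zero: "word_rep 0 0 0"
| word_rot: "word_rep h e n \<Longrightarrow> word_rep (rot c + h) e n"
| word_dir: "word_rep h e n \<Longrightarrow> word_rep (dir c + h) (c + e) (Suc n)"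

lemma act_word: "word_rep h e n \<Longrightarrow> act h [x] = [x + root_shift h]"
proof (induction arbitrary: x rule: word_rep.induct)
  case (word_rot h e n c)
  then have "root_shift (rot c + h) = root_shift h + c" by (intro root_shiftI) (simp add: add.assoc)
  then show ?case using word_rot by (simp add: add.assoc)
next
  case (word_dir h e n c)
  then have "root_shift (dir c + h) = root_shift h" by (intro root_shiftI) simp
  then show ?case using word_dir by simp
qed simp

lemma word_append: "word_rep g d m \<Longrightarrow> word_rep h e n \<Longrightarrow> word_rep (g + h) (d + e) (m + n)"
  by (induction rule: word_rep.induct) (auto simp: add.assoc intro: word_rep.intros)

lemma word_rot_single: "word_rep (rot c) 0 0"
  using word_rot[OF word_zero] by simp

lemma word_dir_single: "word_rep (dir c) c 1"
  using word_dir[OF word_zero, of c] by simp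

lemma word_uminus: "word_rep h e n \<Longrightarrow> word_rep (- h) (- e) n"
proof (induction rule: word_rep.induct)
  case (word_rot h e n c)
  then show ?case using word_append[OF word_rot.IH word_rot_single[of "- c"]]
    by (simp add: minus_add rot_uminus)
next
  case (word_dir h e n c)
  then show ?case using word_append[OF word_dir.IH word_dir_single[of "- c"]]
    by (simp add: minus_add dir_uminus add.commute)
qed (auto intro: word_rep.intros)

lemma shift_plus_word: "word_rep g d m \<Longrightarrow> word_rep h e n \<Longrightarrow> root_shift (g + h) = root_shift g + root_shift h"
  by (rule root_shiftI) (simp add: act_word add.assoc add.commute[of "root_shift h"])

text \<open>Each directed syllable leaves a directed syllable in exactly one section and rotations or nothing in the
others, so exponents and lengths of a word are shared out among its sections. One section keeps the whole length
only if all syllables act below the same letter; then they merge into a single one, which is the last clause.\<close>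
lemma word_sections:
  assumes "word_rep h e n"
  shows "\<exists>es ns. (\<forall>x. word_rep (sec h [x]) (es x) (ns x)) \<and> (\<Sum>x\<in>UNIV. es x) = e \<and>
     (\<Sum>x\<in>UNIV. ns x) = n \<and> (\<Sum>x\<in>UNIV. root_shift (sec h [x])) = 0 \<and> e = dir_exp h \<and>
     (\<forall>x. ns x = n \<longrightarrow> (\<exists>c. h = rot c + dir e - rot x))"
  using assms
proof (induction rule: word_rep.induct)
  case word_zero
  show ?case
  proof (intro exI conjI)
    show "\<forall>x. word_rep (sec 0 [x]) ((\<lambda>_. 0) x) ((\<lambda>_. 0) x)" by (simp add: word_rep.word_zero)
    show "\<forall>x. (0::nat) = 0 \<longrightarrow> (\<exists>c. 0 = rot c + dir 0 - rot x)"
      by (metis add.right_neutral dir_zero right_minus diff_conv_add_uminus)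
  qed (simp_all add: dir_exp_def)
next
  case (word_rot h e n c)
  then obtain es ns where *: "\<forall>x. word_rep (sec h [x]) (es x) (ns x)" "(\<Sum>x\<in>UNIV. es x) = e"
     "(\<Sum>x\<in>UNIV. ns x) = n" "(\<Sum>x\<in>UNIV. root_shift (sec h [x])) = 0" "e = dir_exp h"
     "\<forall>x. ns x = n \<longrightarrow> (\<exists>c. h = rot c + dir e - rot x)" by blast
  have s: "sec (rot c + h) [x] = sec h [x]" for x
    by (simp add: act_word[OF word_rot.hyps])
  have "\<exists>d. rot c + h = rot d + dir e - rot x" if x: "ns x = n" for x
  proof -
    obtain d where "h = rot d + dir e - rot x" using * x by blast
    then have "rot c + h = rot (c + d) + dir e - rot x" by (simp only: rot_plus group_word)
    then show ?thesis by blast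
  qed
  then show ?case using * by (intro exI[of _ es] exI[of _ ns]) (simp add: s dir_exp_def del: sec_plus)
next
  case (word_dir h e n c)
  then obtain es ns where *: "\<forall>x. word_rep (sec h [x]) (es x) (ns x)" "(\<Sum>x\<in>UNIV. es x) = e"
     "(\<Sum>x\<in>UNIV. ns x) = n" "(\<Sum>x\<in>UNIV. root_shift (sec h [x])) = 0" "e = dir_exp h"
     "\<forall>x. ns x = n \<longrightarrow> (\<exists>c. h = rot c + dir e - rot x)" by blast
  let ?s = "root_shift h"
  define d where "d y = root_shift (sec (dir c) [y])" for y
  have d: "d 0 = 0" "d 1 = c" "d 2 = - c" "d 3 = 0" "d 4 = 0" "d 5 = 0" "d 6 = 0"
    by (simp_all add: d_def)
  have s: "sec (dir c + h) [x] = sec (dir c) [x + ?s] + sec h [x]" for x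
    by (simp add: act_word[OF word_dir.hyps] del: sec_dir)
  have Rb: "word_rep (sec (dir c) [y]) (if y = 0 then c else 0) (if y = 0 then 1 else 0)" for y
    using word_rot_single word_dir_single[of c] word_rep.word_zero by simp
  have R1: "word_rep (sec (dir c + h) [x]) ((if x = - ?s then c else 0) + es x) ((if x = - ?s then 1 else 0) + ns x)" for x
    unfolding s eq_neg_iff_add_eq_0 using *(1) by (intro word_append[OF Rb]) blast
  have shs: "root_shift (sec (dir c + h) [x]) = d (x + ?s) + root_shift (sec h [x])" for x
    unfolding s d_def using shift_plus_word Rb[of "x + ?s"] *(1) by blast
  have sum0: "(\<Sum>x\<in>UNIV. d (x + ?s)) = 0"
    unfolding sum_shift7 sum7 by (simp add: d)
  have "(\<Sum>x\<in>UNIV. x * d (x + ?s)) = (\<Sum>x\<in>UNIV. (\<lambda>y. (y - ?s) * d y) (x + ?s))"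
    by simp
  also have "\<dots> = (\<Sum>y\<in>UNIV. (y - ?s) * d y)" by (rule sum_shift7)
  also have "\<dots> = (\<Sum>y\<in>UNIV. y * d y) - ?s * (\<Sum>y\<in>UNIV. d y)"
    by (simp add: left_diff_distrib sum_subtractf sum_distrib_left)
  also have "\<dots> = - c"
    unfolding sum7 by (simp add: d)
  finally have dir_exp: "dir_exp (dir c + h) = c + e"
    unfolding dir_exp_def shs using *(5) by (simp add: distrib_left sum.distrib dir_exp_def)
  have nf: "\<exists>c'. dir c + h = rot c' + dir (c + e) - rot x"
    if "(if x = - ?s then 1 else 0) + ns x = Suc n" for x
  proof -
    \<comment> \<open>The length at \<open>x\<close> is full both before and after the new syllable, which therefore acts below the same letter as the earlier ones.\<close>
    have "ns x \<le> n" using *(3) member_le_sum[of x UNIV ns] by simp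
    with that have x: "x = - ?s" "ns x = n" by (auto split: if_splits)
    then obtain c' where c': "h = rot c' + dir e - rot x" using * by blast
    then have "act h [x] = [c']"
      by (simp only: diff_conv_add_uminus act_plus act_rot act_dir flip: rot_uminus) simp
    then have "c' = 0" using act_word[OF word_dir.hyps, of x] x by simp
    then have "dir c + h = rot 0 + dir (c + e) - rot x"
      unfolding c' by (simp add: dir_plus add.assoc diff_conv_add_uminus del: add_uminus_conv_diff)
    then show ?thesis by blast
  qed
  show ?case
    by (rule exI[of _ "\<lambda>x. (if x = - ?s then c else 0) + es x"],
        rule exI[of _ "\<lambda>x. (if x = - ?s then 1 else 0) + ns x"])
      (use R1 *(2-4) dir_exp nf in \<open>simp add: sum.distrib shs sum0 del: sec_plus\<close>)
qed

lemma word_dexp: "word_rep h e n \<Longrightarrow> e = dir_exp h"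
  using word_sections by blast

definition GGS :: "7 taut set" where
  "GGS = {h. \<exists>e n. word_rep h e n}"

lemma GGS_subgroup: "is_subgroup GGS"
  by (rule is_subgroupI) (auto simp: GGS_def intro: word_rep.intros word_append word_uminus)

lemmas GGS_closed = is_subgroupD[OF GGS_subgroup]

lemma rot_GGS [simp]: "rot c \<in> GGS" and dir_GGS [simp]: "dir c \<in> GGS"
  using word_rot_single word_dir_single by (auto simp: GGS_def)

lemma sec_GGS: "h \<in> GGS \<Longrightarrow> sec h [x] \<in> GGS"
  using word_sections unfolding GGS_def by blast

lemma act_GGS: "h \<in> GGS \<Longrightarrow> act h [x] = [x + root_shift h]"
  using act_word unfolding GGS_def by blast

lemma shift_plus: "g \<in> GGS \<Longrightarrow> h \<in> GGS \<Longrightarrow> root_shift (g + h) = root_shift g + root_shift h"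
  using shift_plus_word unfolding GGS_def by blast

lemma dexp_plus:
  assumes "g \<in> GGS" "h \<in> GGS" shows "dir_exp (g + h) = dir_exp g + dir_exp h"
proof -
  obtain d m e n where "word_rep g d m" "word_rep h e n" using assms by (auto simp: GGS_def)
  then show ?thesis using word_dexp word_dexp[OF word_append] by simp
qed

lemma dexp_rot [simp]: "dir_exp (rot c) = 0"
  by (rule word_dexp[OF word_rot_single, symmetric])

lemma dexp_dir [simp]: "dir_exp (dir c) = c"
  by (rule word_dexp[OF word_dir_single, symmetric])

lemma shift_uminus: "h \<in> GGS \<Longrightarrow> root_shift (- h) = - root_shift h"
  using shift_plus[of "- h" h] GGS_closed(3) by (simp add: eq_neg_iff_add_eq_0)

lemma dexp_zero [simp]: "dir_exp 0 = 0"
  by (rule word_dexp[OF word_zero, symmetric])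

lemma dexp_uminus: "h \<in> GGS \<Longrightarrow> dir_exp (- h) = - dir_exp h"
  using dexp_plus[of "- h" h] GGS_closed(3) by (simp add: eq_neg_iff_add_eq_0)

lemma shift_minus: "g \<in> GGS \<Longrightarrow> h \<in> GGS \<Longrightarrow> root_shift (g - h) = root_shift g - root_shift h"
  using shift_plus[of g "- h"] GGS_closed(3) by (simp add: shift_uminus)

lemma dexp_minus: "g \<in> GGS \<Longrightarrow> h \<in> GGS \<Longrightarrow> dir_exp (g - h) = dir_exp g - dir_exp h"
  using dexp_plus[of g "- h"] GGS_closed(3) by (simp add: dexp_uminus)

lemma GGS_induct:
  assumes "h \<in> GGS" "is_subgroup S" "\<And>c. rot c \<in> S" "\<And>c. dir c \<in> S"
  shows "h \<in> S"
proof -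
  obtain e n where "word_rep h e n" using assms(1) by (auto simp: GGS_def)
  then show ?thesis
    by (induction rule: word_rep.induct) (use assms is_subgroupD[OF assms(2)] in auto)
qed

definition GGS_comm :: "7 taut set" where
  "GGS_comm = {h \<in> GGS. root_shift h = 0 \<and> dir_exp h = 0}"

lemma comm_subset_GGS: "GGS_comm \<subseteq> GGS"
  by (auto simp: GGS_comm_def)

lemma comm_subgroup: "is_subgroup GGS_comm"
  by (rule is_subgroupI) (auto simp: GGS_comm_def shift_plus dexp_plus shift_uminus dexp_uminus GGS_closed)

lemmas comm_closed = is_subgroupD[OF comm_subgroup]

lemma comm_normal: "normalised_by GGS_comm GGS"
  by (auto simp: normalised_by_def GGS_comm_def shift_plus dexp_plus shift_minus dexp_minus GGS_closed)

lemma commutator_comm: "g \<in> GGS \<Longrightarrow> h \<in> GGS \<Longrightarrow> g + h - g - h \<in> GGS_comm"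
  by (simp add: GGS_comm_def shift_plus dexp_plus shift_minus dexp_minus GGS_closed)

text \<open>Modulo a normal subgroup that contains the commutators of the generators, every word can be sorted to
\<open>rot s + dir e\<close>; for elements of \<open>GGS_comm\<close> both parts vanish. Thus \<open>GGS_comm\<close>, defined by the vanishing
of the two invariants, is the commutator subgroup of \<open>GGS\<close>.\<close>
lemma comm_least:
  assumes P: "is_subgroup P" "normalised_by P GGS"
    and comm: "\<And>c d. dir c + rot d - dir c - rot d \<in> P"
  shows "GGS_comm \<subseteq> P"
proof -
  let ?Q = "P \<inter> GGS_comm"
  have Q: "a + b \<in> ?Q" if "a \<in> ?Q" "b \<in> ?Q" for a b
    using that is_subgroupD(2)[OF P(1)] comm_closed(2) by auto
  have Qn: "g + a - g \<in> ?Q" if "g \<in> GGS" "a \<in> ?Q" for g a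
    using that normalised_byD[OF P(2)] normalised_byD[OF comm_normal] by auto
  have Qc: "dir c + rot d - dir c - rot d \<in> ?Q" for c d
    using comm commutator_comm by simp
  \<comment> \<open>Intersecting with \<open>GGS_comm\<close> ensures that \<open>p\<close> has trivial invariants, so that \<open>s\<close> and \<open>e\<close> can be read off from \<open>h\<close>.\<close>
  have nf: "word_rep h e n \<Longrightarrow> \<exists>p\<in>?Q. \<exists>s. h = p + rot s + dir e" for h e n
  proof (induction rule: word_rep.induct)
    case word_zero
    have "0 = 0 + rot 0 + dir 0" by simp
    moreover have "0 \<in> ?Q" using is_subgroupD(1)[OF P(1)] comm_closed(1) by simp
    ultimately show ?case by (intro bexI exI)
  next
    case (word_rot h e n c)
    then obtain p s where p: "p \<in> ?Q" "h = p + rot s + dir e" by blast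
    have "rot c + h = (rot c + p - rot c) + rot (c + s) + dir e"
      unfolding p(2) by (simp only: rot_plus group_word)
    then show ?case using Qn[OF rot_GGS p(1)] by (intro bexI exI)
  next
    case (word_dir h e n c)
    then obtain p s where p: "p \<in> ?Q" "h = p + rot s + dir e" by blast
    have "dir c + h = (dir c + p - dir c + (dir c + rot s - dir c - rot s)) + rot s + dir (c + e)"
      unfolding p(2) by (simp only: dir_plus group_word)
    then show ?case using Q[OF Qn[OF dir_GGS p(1)] Qc] by (intro bexI exI)
  qed
  show ?thesis
  proof
    fix k assume k: "k \<in> GGS_comm"
    then obtain e n where wr: "word_rep k e n" by (auto simp: GGS_comm_def GGS_def)
    then obtain p s where p: "p \<in> ?Q" "k = p + rot s + dir e" using nf by blast
    have "e = 0" using k word_dexp[OF wr] by (simp add: GGS_comm_def)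
    then have k': "k = p + rot s" using p(2) by simp
    have "p \<in> GGS" "root_shift p = 0" using p(1) by (auto simp: GGS_comm_def)
    then have "s = 0" using k k' by (simp add: GGS_comm_def shift_plus)
    then show "k \<in> P" using k' p(1) by simp
  qed
qed

lemma act_fix: "g \<in> GGS \<Longrightarrow> root_shift g = 0 \<Longrightarrow> act g [x] = [x]"
  by (simp add: act_GGS)

definition dir_at :: "7 \<Rightarrow> 7 \<Rightarrow> 7 taut" where
  "dir_at i c = rot i + dir c - rot i"

lemma dir_at_GGS [simp]: "dir_at i c \<in> GGS"
  by (simp add: dir_at_def GGS_closed)

lemma shift_dir_at [simp]: "root_shift (dir_at i c) = 0" and dexp_dir_at [simp]: "dir_exp (dir_at i c) = c"
  by (simp_all add: dir_at_def shift_plus shift_minus dexp_plus dexp_minus GGS_closed)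

lemma sec_dir_at [simp]: "sec (dir_at i c) [x] = sec (dir c) [x - i]"
  using sec_conj[of "rot i" "dir c" "[x - i]"] by (simp add: dir_at_def del: sec_dir)

text \<open>The sections at \<open>x\<close> of the translates of \<open>dir c\<close> based at \<open>x\<close> and at \<open>x - 1\<close> are the two kinds of generators.\<close>
lemma self_replicating_one: "l \<in> GGS \<Longrightarrow> \<exists>g\<in>GGS. root_shift g = 0 \<and> sec g [x] = l"
proof -
  let ?S = "{sec g [x] | g. g \<in> GGS \<and> root_shift g = 0}"
  have S: "is_subgroup ?S"
  proof (rule is_subgroupI)
    show "0 \<in> ?S" by (rule CollectI, rule exI[of _ 0]) (simp add: GGS_closed)
    show "a + b \<in> ?S" if ab: "a \<in> ?S" "b \<in> ?S" for a b
    proof -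
      obtain g where "a = sec g [x]" "g \<in> GGS" "root_shift g = 0" using ab(1) by blast
      moreover obtain h where "b = sec h [x]" "h \<in> GGS" "root_shift h = 0" using ab(2) by blast
      ultimately show ?thesis
        by (intro CollectI exI[of _ "g + h"]) (simp add: act_fix shift_plus GGS_closed)
    qed
    show "- a \<in> ?S" if a: "a \<in> ?S" for a
    proof -
      obtain g where "a = sec g [x]" "g \<in> GGS" "root_shift g = 0" using a by blast
      then show ?thesis
        by (intro CollectI exI[of _ "- g"]) (simp add: act_fix sec_uminus_fix shift_uminus GGS_closed)
    qed
  qed
  have "rot c \<in> ?S" for c
    by (rule CollectI, rule exI[of _ "dir_at (x - 1) c"]) simp
  moreover have "dir c \<in> ?S" for c
    by (rule CollectI, rule exI[of _ "dir_at x c"]) simp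
  ultimately show "l \<in> GGS \<Longrightarrow> ?thesis" using GGS_induct[OF _ S] by blast
qed

lemma self_replicating: "l \<in> GGS \<Longrightarrow> \<exists>g\<in>GGS. act g v = v \<and> sec g v = l"
proof (induction v)
  case (Cons x v)
  then obtain h where "h \<in> GGS" "act h v = v" "sec h v = l" by blast
  moreover obtain g where "g \<in> GGS" "root_shift g = 0" "sec g [x] = h"
    using self_replicating_one[OF \<open>h \<in> GGS\<close>] by blast
  ultimately show ?case
    using sec_append[of g "[x]" v] by (intro bexI[of _ g]) (simp_all add: act_Cons[of g x v] act_fix)
qed auto

lemma GGS_transitive: "length u = length v \<Longrightarrow> \<exists>g\<in>GGS. act g u = v"
proof (induction u v rule: list_induct2)
  case Nil
  show ?case using GGS_closed(1) by (intro bexI[of _ 0]) simp_all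
next
  case (Cons x u y v)
  then obtain h where h: "h \<in> GGS" "act h u = v" by blast
  then obtain g where g: "g \<in> GGS" "root_shift g = 0" "sec g [y] = h"
    using self_replicating_one by blast
  show ?case
  proof (rule bexI)
    show "act (g + rot (y - x)) (x # u) = y # v"
      using g h act_Cons[of g y u] by (simp add: act_fix)
    show "g + rot (y - x) \<in> GGS" using g GGS_closed(2) by simp
  qed
qed

text \<open>The differences \<open>dir_at 3 c - dir_at 4 c\<close> and \<open>dir_at 0 d - dir_at 1 d\<close> of neighbouring translates lie in
\<open>GGS_comm\<close> and are supported on the letters \<open>3, 4, 5, 6\<close> and \<open>0, 1, 2, 3\<close>. At the common letter 3 their sections
are \<open>dir c\<close> and \<open>rot d\<close>, so their commutator is the basic commutator \<open>[dir c, rot d]\<close> placed below 3. This is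
stronger than the usual branching over the commutator subgroup: the commutators of \<open>GGS_comm\<close> with itself suffice.\<close>
lemma commutators_of_comm:
  assumes S: "is_subgroup S" "normalised_by S GGS"
    and comm: "\<And>a b. a \<in> GGS_comm \<Longrightarrow> b \<in> GGS_comm \<Longrightarrow> a + b - a - b \<in> S"
    and k: "k \<in> GGS_comm"
  shows "at_vertex [x] k \<in> S"
proof -
  note SD = is_subgroupD[OF S(1)]
  let ?P = "{p. at_vertex [3] p \<in> S}"
  have "GGS_comm \<subseteq> ?P"
  proof (rule comm_least)
    show "is_subgroup ?P"
      by (rule is_subgroupI) (auto simp: vertex_plus vertex_uminus SD)
    show "normalised_by ?P GGS"
      unfolding normalised_by_def
    proof (intro ballI)
      fix l p assume l: "l \<in> GGS" and p: "p \<in> ?P"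
      obtain g where g: "g \<in> GGS" "root_shift g = 0" "sec g [3] = l"
        using self_replicating_one[OF l] by blast
      have "g + at_vertex [3] p - g \<in> S" using normalised_byD[OF S(2) g(1)] p by simp
      then show "l + p - l \<in> ?P" unfolding vertex_conj using g by (simp add: act_fix)
    qed
    show "dir c + rot d - dir c - rot d \<in> ?P" for c d
    proof -
      let ?a = "dir_at 3 c + dir_at 4 (- c)" and ?b = "dir_at 0 d + dir_at 1 (- d)"
      have ab: "?a \<in> GGS_comm" "?b \<in> GGS_comm" by (simp_all add: GGS_comm_def shift_plus dexp_plus GGS_closed)
      have fx: "act (dir_at i c') [x] = [x]" "act (- dir_at i c') [x] = [x]" for i c' x
        by (simp_all add: act_fix act_fix_uminus)
      have sc: "sec (?a + ?b - ?a - ?b) [x] =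
          sec ?a [x] + sec ?b [x] - sec ?a [x] - sec ?b [x]" for x
        by (simp only: diff_conv_add_uminus minus_add sec_plus act_plus fx sec_uminus add.assoc)
      have ac: "act (?a + ?b - ?a - ?b) [x] = [x]" for x
        by (simp only: diff_conv_add_uminus minus_add act_plus fx)
      have "\<forall>x. sec ?a [x] = (if x = 3 then dir c else if x = 4 then rot c + dir (- c) else
          if x = 5 then rot (- c) + rot (- c) else if x = 6 then rot c else 0)"
        and "\<forall>x. sec ?b [x] = (if x = 0 then dir d else if x = 1 then rot d + dir (- d) else
          if x = 2 then rot (- d) + rot (- d) else if x = 3 then rot d else 0)"
        unfolding all7 by (simp_all add: fx)
      note se = this[rule_format]
      have "?a + ?b - ?a - ?b = at_vertex [3] (dir c + rot d - dir c - rot d)"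
      proof (rule level_one_eqI)
        show "sec (?a + ?b - ?a - ?b) [x] = sec (at_vertex [3] (dir c + rot d - dir c - rot d)) [x]" for x
          unfolding sc se by (auto simp: sec_vertex_Cons)
      qed (simp only: ac act_vertex_Cons)
      then show ?thesis using comm[OF ab] by simp
    qed
  qed
  then have "at_vertex [3] k \<in> S" using k by blast
  then have "rot (x - 3) + at_vertex [3] k - rot (x - 3) \<in> S" using normalised_byD[OF S(2)] by simp
  then show ?thesis unfolding vertex_conj by simp
qed

lemma comm_vertex: "k \<in> GGS_comm \<Longrightarrow> at_vertex w k \<in> GGS_comm"
proof (induction w)
  case (Cons x w)
  have "at_vertex [x] (at_vertex w k) \<in> GGS_comm"
    by (rule commutators_of_comm[OF comm_subgroup comm_normal])
      (use Cons commutator_comm comm_subset_GGS in auto)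
  then show ?case by (simp flip: vertex_append)
qed simp

section \<open>Products of commutator subgroups over a layer, and normal subgroups\<close>

lemma act_single: "\<exists>y. act g [x] = [y]"
proof -
  have "length (act g [x]) = Suc 0" by simp
  then show ?thesis unfolding length_Suc_conv by auto
qed

lemma sec_GGS_word: "h \<in> GGS \<Longrightarrow> sec h v \<in> GGS"
proof (induction v arbitrary: h)
  case (Cons x v)
  then show ?case using sec_append[of h "[x]" v] sec_GGS[of h x] by simp
qed simp

text \<open>An element that fixes the first layer is the product of its sections, placed below their letters.\<close>
lemma subgroup_contains_parts:
  fixes g :: "'x::finite taut"
  assumes S: "is_subgroup S" and fx: "\<And>x. act g [x] = [x]" and at: "\<And>x. at_vertex [x] (sec g [x]) \<in> S"
  shows "g \<in> S"
proof -
  note SD = is_subgroupD[OF S]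
  have "g \<in> S" if "\<And>x. act g [x] = [x]" "\<And>x. at_vertex [x] (sec g [x]) \<in> S"
    "\<And>x. x \<notin> A \<Longrightarrow> sec g [x] = 0" "finite A" for A and g :: "'x taut"
    using that(4,1-3)
  proof (induction A arbitrary: g rule: finite_induct)
    case empty
    have "g = 0" by (rule level_one_eqI) (simp_all add: empty)
    then show ?case using SD by simp
  next
    case (insert a A)
    let ?a = "at_vertex [a] (sec g [a])"
    have f: "act (- ?a) [y] = [y]" for y by (simp add: act_fix_uminus)
    have s: "sec (- ?a + g) [y] = (if y = a then 0 else sec g [y])" for y
      using insert.prems(1) by (simp add: sec_uminus_fix)
    have "- ?a + g \<in> S"
    proof (rule insert.IH)
      show "act (- ?a + g) [x] = [x]" for x using insert.prems(1) f by simp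
      show "at_vertex [x] (sec (- ?a + g) [x]) \<in> S" for x
        unfolding s using insert.prems(2) SD(1) by simp
      show "x \<notin> A \<Longrightarrow> sec (- ?a + g) [x] = 0" for x
        unfolding s using insert.prems(3) by simp
    qed
    then have "?a + (- ?a + g) \<in> S" using SD(2) insert.prems(2) by blast
    then show ?case by (simp only: add_minus_cancel)
  qed
  from this[where A = UNIV, OF fx at] show ?thesis by simp
qed

text \<open>The direct product of the copies of \<open>GGS_comm\<close> at the vertices of layer \<open>n\<close>; these subgroups take over the role of
the finite-index normal subgroups.\<close>
primrec level_comm :: "nat \<Rightarrow> 7 taut set" where
  "level_comm 0 = GGS_comm"
| "level_comm (Suc n) = {g. \<forall>x. act g [x] = [x] \<and> sec g [x] \<in> level_comm n}"

lemma level_subgroup: "is_subgroup (level_comm n)"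
proof (induction n)
  case (Suc n)
  note D = is_subgroupD[OF Suc]
  show ?case by (rule is_subgroupI) (auto simp: D act_fix_uminus sec_uminus_fix)
qed (simp add: comm_subgroup)

lemmas level_closed = is_subgroupD[OF level_subgroup]

lemma level_least:
  assumes "is_subgroup S" "\<And>w k. length w = n \<Longrightarrow> k \<in> GGS_comm \<Longrightarrow> at_vertex w k \<in> S"
  shows "level_comm n \<subseteq> S"
  using assms
proof (induction n arbitrary: S)
  case 0
  from 0(2)[of "[]"] show ?case by auto
next
  case (Suc n)
  note D = is_subgroupD[OF Suc.prems(1)]
  have *: "level_comm n \<subseteq> {k. at_vertex [x] k \<in> S}" for x
  proof (rule Suc.IH)
    show "is_subgroup {k. at_vertex [x] k \<in> S}"
      by (rule is_subgroupI) (auto simp: D vertex_plus vertex_uminus)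
    show "at_vertex w k \<in> {k. at_vertex [x] k \<in> S}" if "length w = n" "k \<in> GGS_comm" for w k
      using Suc.prems(2)[of "x # w" k] that by (simp flip: vertex_append)
  qed
  show ?case
  proof
    fix g assume "g \<in> level_comm (Suc n)"
    then have g: "\<And>x. act g [x] = [x]" "\<And>x. sec g [x] \<in> level_comm n" by simp_all
    show "g \<in> S" by (rule subgroup_contains_parts[OF Suc.prems(1) g(1)]) (use * g(2) in blast)
  qed
qed

lemma vertex_level: "m \<le> length w \<Longrightarrow> k \<in> GGS_comm \<Longrightarrow> at_vertex w k \<in> level_comm m"
proof (induction m arbitrary: w)
  case (Suc m)
  then obtain x v where w: "w = x # v" by (cases w) auto
  then show ?case using Suc level_closed(1) by simp
qed (simp add: comm_vertex)

lemma level_antimono: "m \<le> n \<Longrightarrow> level_comm n \<subseteq> level_comm m"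
  by (rule level_least[OF level_subgroup]) (simp add: vertex_level)

lemma level_subset_comm: "level_comm n \<subseteq> GGS_comm"
  using level_antimono[of 0 n] by simp

definition GGS_wreath :: "7 taut set" where
  "GGS_wreath = {g. \<forall>x. sec g [x] \<in> GGS}"

lemma GGS_subset_wreath: "GGS \<subseteq> GGS_wreath"
  by (auto simp: GGS_wreath_def sec_GGS)

lemma sec_wreath: "g \<in> GGS_wreath \<Longrightarrow> length u = 1 \<Longrightarrow> sec g u \<in> GGS"
  by (auto simp: GGS_wreath_def length_Suc_conv)

lemma wreath_subgroup: "is_subgroup GGS_wreath"
proof (rule is_subgroupI)
  show "0 \<in> GGS_wreath" by (simp add: GGS_wreath_def GGS_closed)
  show "a + b \<in> GGS_wreath" if "a \<in> GGS_wreath" "b \<in> GGS_wreath" for a b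
    using sec_wreath[OF that(1)] sec_wreath[OF that(2)] GGS_closed(2) by (simp add: GGS_wreath_def)
  show "- a \<in> GGS_wreath" if "a \<in> GGS_wreath" for a
    using sec_wreath[OF that] GGS_closed(3) by (simp add: GGS_wreath_def sec_uminus)
qed

lemmas GGS_wreath_closed = is_subgroupD[OF wreath_subgroup]

lemma level_Suc_subset_wreath: "level_comm (Suc n) \<subseteq> GGS_wreath"
  using level_subset_comm comm_subset_GGS GGS_subset_wreath by blast

lemma level_Suc_normal_step:
  assumes n: "normalised_by (level_comm n) GGS" shows "normalised_by (level_comm (Suc n)) GGS_wreath"
  unfolding normalised_by_def
proof (intro ballI)
  fix g k assume g: "g \<in> GGS_wreath" and k: "k \<in> level_comm (Suc n)"
  have "act (g + k - g) [y] = [y] \<and> sec (g + k - g) [y] \<in> level_comm n" for y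
  proof -
    obtain x where x: "act (- g) [y] = [x]" using act_single[of "- g" y] by blast
    then have y: "[y] = act g [x]" by (metis act_act_uminus(1))
    have "sec g [x] + sec k [x] - sec g [x] \<in> level_comm n"
      using n g k by (simp add: normalised_by_def GGS_wreath_def)
    moreover have "act (g + k - g) [y] = [y]"
      using k x y by (simp only: diff_conv_add_uminus act_plus) simp
    ultimately show ?thesis unfolding y sec_conj using k by simp
  qed
  then show "g + k - g \<in> level_comm (Suc n)" by simp
qed

lemma level_normal: "normalised_by (level_comm n) GGS"
proof (induction n)
  case (Suc n)
  show ?case using level_Suc_normal_step[OF Suc] GGS_subset_wreath unfolding normalised_by_def by blast
qed (simp add: comm_normal)

lemma level_Suc_normal: "normalised_by (level_comm (Suc n)) GGS_wreath"
  by (rule level_Suc_normal_step[OF level_normal])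

text \<open>If \<open>h\<close> in \<open>N\<close> moves \<open>v\<close> and \<open>f, g\<close> are supported below \<open>v\<close>, then \<open>[h, f]\<close> acts below \<open>v\<close> as the inverse of \<open>f\<close> and
otherwise only below the image of \<open>v\<close>, so \<open>[[h, f], g]\<close> is the commutator of the inverse of \<open>f\<close> with \<open>g\<close>, below \<open>v\<close>. Hence \<open>N\<close>
contains the commutators of \<open>GGS_comm\<close> below \<open>v\<close>, and with them \<open>GGS_comm\<close> itself one layer further down.\<close>
lemma nontrivial_normal_contains_level:
  assumes N: "is_subgroup N" "normalised_by N GGS" "N \<noteq> {0}"
  shows "\<exists>n. level_comm n \<subseteq> N"
proof -
  note ND = is_subgroupD[OF N(1)]
  obtain h where h: "h \<in> N" "h \<noteq> 0" using N(3) ND(1) by blast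
  then obtain v where v: "act h v \<noteq> v" by (metis act_zero taut_eqI)
  have comm_N: "a + g - a - g \<in> N" if "a \<in> N" "g \<in> GGS" for a g
  proof -
    have "g + - a - g \<in> N" using normalised_byD[OF N(2)] ND(3) that by blast
    then have "a + (g + - a - g) \<in> N" using ND(2) that by blast
    then show ?thesis by (simp only: group_word)
  qed
  let ?P = "{k. at_vertex v k \<in> N}"
  have P: "is_subgroup ?P"
    by (rule is_subgroupI) (auto simp: ND vertex_plus vertex_uminus)
  have "normalised_by ?P GGS"
    unfolding normalised_by_def
  proof (intro ballI)
    fix l p assume l: "l \<in> GGS" and p: "p \<in> ?P"
    obtain g where g: "g \<in> GGS" "act g v = v" "sec g v = l"
      using self_replicating[OF l] by blast
    have "g + at_vertex v p - g \<in> N" using normalised_byD[OF N(2) g(1)] p by simp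
    then show "l + p - l \<in> ?P" unfolding vertex_conj using g by simp
  qed
  moreover have "a + b - a - b \<in> ?P" if ab: "a \<in> GGS_comm" "b \<in> GGS_comm" for a b
  proof -
    let ?F = "at_vertex v (- a)" and ?G = "at_vertex v b"
    have FG: "?F \<in> GGS" "?G \<in> GGS" using comm_vertex[of "- a" v] comm_vertex[OF ab(2)] ab comm_closed(3) comm_subset_GGS by auto
    define x where "x = h + ?F - h - ?F"
    define g where "g = ?G"
    have x: "x + g - x - g \<in> N" unfolding x_def g_def using comm_N FG h by blast
    have fF: "act ?F u = u" "act (- ?F) u = u" "act g u = u" "act (- g) u = u"
      if "length u = length v" for u
      using that unfolding g_def by (simp_all add: act_vertex_level act_fix_uminus)
    have fx: "act x u = u" "act (- x) u = u" if "length u = length v" for u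
    proof -
      show "act x u = u" unfolding x_def vertex_conj using that
        by (simp only: diff_conv_add_uminus act_plus fF act_vertex_level length_act)
      then show "act (- x) u = u" by (rule act_fix_uminus)
    qed
    have sx: "sec x v = a"
      unfolding x_def vertex_conj using v
      by (simp only: diff_conv_add_uminus sec_plus fF sec_uminus sec_vertex_level length_act) simp
    have "x + g - x - g = at_vertex v (a + b - a - b)"
    proof (rule level_eqI[where n = "length v"])
      fix u :: "7 list" assume u: "length u = length v"
      show "act (x + g - x - g) u = act (at_vertex v (a + b - a - b)) u"
        using u by (simp only: diff_conv_add_uminus act_plus fF fx act_vertex_level)
      have "sec (x + g - x - g) u = sec x u + sec g u - sec x u - sec g u"
        using u by (simp only: diff_conv_add_uminus sec_plus sec_uminus act_plus fF fx)
      then show "sec (x + g - x - g) u = sec (at_vertex v (a + b - a - b)) u"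
        using u sx by (cases "u = v") (simp_all add: g_def sec_vertex_level)
    qed
    then show ?thesis using x by simp
  qed
  ultimately have P0: "at_vertex [0] k \<in> ?P" if "k \<in> GGS_comm" for k
    using commutators_of_comm[OF P] that by blast
  let ?u = "v @ [0]"
  have "level_comm (length ?u) \<subseteq> N"
  proof (rule level_least[OF N(1)])
    fix w :: "7 list" and k assume w: "length w = length ?u" and k: "k \<in> GGS_comm"
    obtain g where g: "g \<in> GGS" "act g ?u = w" using GGS_transitive[of ?u w] w by metis
    let ?s = "sec g ?u"
    have "- ?s + k - - ?s \<in> GGS_comm"
      using normalised_byD[OF comm_normal] k sec_GGS_word[OF g(1)] GGS_closed(3) by blast
    then have "at_vertex ?u (- ?s + k - - ?s) \<in> N" using P0 by (simp add: vertex_append)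
    then have "g + at_vertex ?u (- ?s + k - - ?s) - g \<in> N" using normalised_byD[OF N(2) g(1)] by blast
    then show "at_vertex w k \<in> N" unfolding vertex_conj g(2) by (simp only: group_word)
  qed
  then show ?thesis by blast
qed

lemma comm_nontrivial: "\<exists>k\<in>GGS_comm. k \<noteq> 0"
proof (rule bexI)
  let ?k = "dir_at 0 1 - dir_at 1 1"
  show "?k \<in> GGS_comm" by (simp add: GGS_comm_def shift_minus dexp_minus GGS_closed)
  have "sec ?k [0] = dir 1"
    by (simp only: diff_conv_add_uminus sec_plus sec_uminus act_fix_uminus act_fix dir_at_GGS shift_dir_at) simp
  then show "?k \<noteq> 0" by (metis dexp_dir dexp_zero sec_zero zero_neq_one)
qed

text \<open>An element of \<open>M\<close> moves some vertex, hence also a vertex as deep as desired, and \<open>N\<close> contains elements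
supported below that deep vertex only. Conjugation moves their support.\<close>
lemma nontrivial_normal_not_commuting:
  assumes M: "is_subgroup M" "normalised_by M GGS" "M \<noteq> {0}"
    and N: "is_subgroup N" "normalised_by N GGS" "N \<noteq> {0}"
  shows "\<exists>a\<in>M. \<exists>b\<in>N. a + b \<noteq> b + a"
proof -
  obtain h where h: "h \<in> M" "h \<noteq> 0" using M(3) is_subgroupD(1)[OF M(1)] by blast
  then obtain v where v: "act h v \<noteq> v" by (metis act_zero taut_eqI)
  obtain n where n: "level_comm n \<subseteq> N" using nontrivial_normal_contains_level[OF N] by blast
  obtain k where k: "k \<in> GGS_comm" "k \<noteq> 0" using comm_nontrivial by blast
  let ?w = "v @ replicate n 0"
  have w: "act h ?w \<noteq> ?w" using v by (metis take_act append_eq_conv_conj)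
  have "at_vertex ?w k \<in> N" using n vertex_level[of n ?w k] k by auto
  moreover have "h + at_vertex ?w k \<noteq> at_vertex ?w k + h"
  proof
    assume "h + at_vertex ?w k = at_vertex ?w k + h"
    then have "h + at_vertex ?w k - h = at_vertex ?w k" by simp
    then have "sec (at_vertex (act h ?w) (sec h ?w + k - sec h ?w)) ?w = k"
      unfolding vertex_conj by simp
    then show False using w k(2) by (simp add: sec_vertex_level)
  qed
  ultimately show ?thesis using h by blast
qed

text \<open>Only the layers from 1 on are used, because \<open>level_comm 0\<close> is normalised by \<open>GGS\<close> but not by the wreath product.\<close>
definition dense_in :: "7 taut set \<Rightarrow> 7 taut set \<Rightarrow> bool" where
  "dense_in H G \<longleftrightarrow> (\<forall>n. \<forall>g\<in>G. \<exists>h\<in>H. \<exists>k\<in>level_comm (Suc n). g = h + k)"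

definition fixes_level_one :: "7 taut \<Rightarrow> bool" where
  "fixes_level_one g \<longleftrightarrow> (\<forall>x. act g [x] = [x])"

lemma fixes_level_oneD [simp]: "fixes_level_one g \<Longrightarrow> act g [x] = [x]"
  by (simp add: fixes_level_one_def)

lemma fixes_level_one_closed: "fixes_level_one 0" "fixes_level_one g \<Longrightarrow> fixes_level_one h \<Longrightarrow> fixes_level_one (g + h)"
  "fixes_level_one g \<Longrightarrow> fixes_level_one (- g)" "fixes_level_one g \<Longrightarrow> fixes_level_one h \<Longrightarrow> fixes_level_one (g - h)"
  by (auto simp: fixes_level_one_def act_fix_uminus simp flip: minus_taut_def)
    (simp add: act_fix_uminus diff_conv_add_uminus del: add_uminus_conv_diff)

lemma sec_uminus_one: "fixes_level_one g \<Longrightarrow> sec (- g) [x] = - sec g [x]"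
  by (simp add: sec_uminus_fix)

lemma sec_minus_one: "fixes_level_one g \<Longrightarrow> fixes_level_one h \<Longrightarrow> sec (g - h) [x] = sec g [x] - sec h [x]"
  using fixes_level_one_closed(3)[of h]
  by (simp add: sec_uminus_one diff_conv_add_uminus del: add_uminus_conv_diff)

section \<open>Dense subgroups whose sections are everything\<close>

text \<open>The groups for \<open>Z = {}\<close> are the section groups of \<open>H\<close>; for \<open>Z\<close> the complement of \<open>{x}\<close> one obtains the elements
of \<open>H\<close> supported below \<open>x\<close>.\<close>
definition sections_off :: "7 taut set \<Rightarrow> 7 set \<Rightarrow> 7 \<Rightarrow> 7 taut set" where
  "sections_off H Z x = {sec h [x] | h. h \<in> H \<and> fixes_level_one h \<and> (\<forall>z\<in>Z. sec h [z] = 0)}"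

lemma sections_offI: "h \<in> H \<Longrightarrow> fixes_level_one h \<Longrightarrow> (\<And>z. z \<in> Z \<Longrightarrow> sec h [z] = 0) \<Longrightarrow> sec h [x] \<in> sections_off H Z x"
  unfolding sections_off_def by blast

lemma sections_offE:
  assumes "a \<in> sections_off H Z x"
  obtains h where "h \<in> H" "fixes_level_one h" "\<And>z. z \<in> Z \<Longrightarrow> sec h [z] = 0" "a = sec h [x]"
  using assms unfolding sections_off_def by blast

lemma sec_conj_one: "fixes_level_one e \<Longrightarrow> fixes_level_one d \<Longrightarrow>
    sec (e + d - e) [x] = sec e [x] + sec d [x] - sec e [x]"
  by (simp add: sec_minus_one fixes_level_one_closed)

lemma sec_comm_one: "fixes_level_one e \<Longrightarrow> fixes_level_one d \<Longrightarrow>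
    sec (e + d - e - d) [x] = sec e [x] + sec d [x] - sec e [x] - sec d [x]"
  by (simp add: sec_minus_one fixes_level_one_closed)

lemma sections_off_subgroup:
  assumes H: "is_subgroup H" shows "is_subgroup (sections_off H Z x)"
proof (rule is_subgroupI)
  note HD = is_subgroupD[OF H]
  show "0 \<in> sections_off H Z x" using sections_offI[of 0 H Z x] HD(1) fixes_level_one_closed(1) by simp
  show "a + b \<in> sections_off H Z x" if a: "a \<in> sections_off H Z x" and b: "b \<in> sections_off H Z x" for a b
  proof -
    obtain g where g: "g \<in> H" "fixes_level_one g" "\<And>z. z \<in> Z \<Longrightarrow> sec g [z] = 0" "a = sec g [x]"
      using a by (rule sections_offE) blast
    obtain h where h: "h \<in> H" "fixes_level_one h" "\<And>z. z \<in> Z \<Longrightarrow> sec h [z] = 0" "b = sec h [x]"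
      using b by (rule sections_offE) blast
    have "sec (g + h) [x] \<in> sections_off H Z x"
      by (rule sections_offI) (use g h HD fixes_level_one_closed in auto)
    then show ?thesis using g h by simp
  qed
  show "- a \<in> sections_off H Z x" if a: "a \<in> sections_off H Z x" for a
  proof -
    obtain g where g: "g \<in> H" "fixes_level_one g" "\<And>z. z \<in> Z \<Longrightarrow> sec g [z] = 0" "a = sec g [x]"
      using a by (rule sections_offE) blast
    have "sec (- g) [x] \<in> sections_off H Z x"
      by (rule sections_offI) (use g HD fixes_level_one_closed in \<open>auto simp: sec_uminus_one\<close>)
    then show ?thesis using g by (simp add: sec_uminus_one)
  qed
qed

lemma sections_off_normal:
  assumes H: "is_subgroup H" shows "normalised_by (sections_off H Z x) (sections_off H {} x)"
  unfolding normalised_by_def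
proof (intro ballI)
  note HD = is_subgroupD[OF H]
  fix l a assume l: "l \<in> sections_off H {} x" and a: "a \<in> sections_off H Z x"
  obtain g where g: "g \<in> H" "fixes_level_one g" "\<And>z. z \<in> Z \<Longrightarrow> sec g [z] = 0" "a = sec g [x]"
    using a by (rule sections_offE) blast
  obtain h where h: "h \<in> H" "fixes_level_one h" "l = sec h [x]"
    using l by (rule sections_offE) blast
  have "sec (h + g - h) [x] \<in> sections_off H Z x"
    by (rule sections_offI) (use g h HD in \<open>simp_all add: fixes_level_one_closed sec_conj_one\<close>)
  then show "l + a - l \<in> sections_off H Z x" using g h by (simp add: sec_conj_one)
qed

lemma not_in_comm: "dir_exp g \<noteq> 0 \<or> root_shift g \<noteq> 0 \<Longrightarrow> g \<notin> GGS_comm"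
  by (auto simp: GGS_comm_def)

text \<open>The supports of the translates of \<open>dir 1\<close> are the sets of three consecutive letters; one of them contains
\<open>x\<close> and misses \<open>z\<close>, and all sections on a support are non-trivial modulo \<open>GGS_comm\<close>.\<close>
lemma separating_generator:
  assumes "x \<noteq> z" shows "\<exists>i. sec (dir_at i 1) [z] = 0 \<and> sec (dir_at i 1) [x] \<in> GGS - GGS_comm"
proof -
  have "\<forall>d::7. d \<noteq> 0 \<longrightarrow> d = 1 \<or> d = 2 \<or> d = 3 \<or> d = 4 \<or> d = 5 \<or> d = 6"
    unfolding all7 by simp
  then consider "z - x = 1 \<or> z - x = 2" | "z - x = 3 \<or> z - x = 4 \<or> z - x = 5 \<or> z - x = 6"
    using assms by (metis eq_iff_diff_eq_0)
  then show ?thesis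
  proof cases
    case 1
    then have "z - (x - 2) = 3 \<or> z - (x - 2) = 4" by (auto simp: algebra_simps)
    then have "sec (dir_at (x - 2) 1) [z] = 0" by auto
    moreover have "sec (dir_at (x - 2) 1) [x] \<in> GGS - GGS_comm"
      using not_in_comm[of "rot (- 1)"] by simp
    ultimately show ?thesis by blast
  next
    case 2
    then have "sec (dir_at x 1) [z] = 0" by auto
    moreover have "sec (dir_at x 1) [x] \<in> GGS - GGS_comm"
      using not_in_comm[of "dir 1"] by simp
    ultimately show ?thesis by blast
  qed
qed

text \<open>Density turns the translate of \<open>dir 1\<close> that separates \<open>x\<close> from \<open>z\<close> into an element of \<open>H\<close> with section in
\<open>GGS_comm\<close> at \<open>z\<close> but not at \<open>x\<close>. The section at \<open>z\<close> is a product of commutators in \<open>GGS\<close>; performing the same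
commutators in \<open>H\<close> gives an element of \<open>H\<close> with this section at \<open>z\<close> whose section at \<open>x\<close> lies in \<open>GGS_comm\<close>. The
quotient is trivial at \<open>z\<close> and non-trivial at \<open>x\<close>.\<close>
lemma sections_off_nontrivial_pair:
  assumes H: "is_subgroup H" and dense: "dense_in H G" and LG: "GGS \<subseteq> G"
    and full: "\<And>x. sections_off H {} x = GGS" and "x \<noteq> z"
  shows "sections_off H {z} x \<noteq> {0}"
proof -
  note HD = is_subgroupD[OF H]
  obtain i where i: "sec (dir_at i 1) [z] = 0" "sec (dir_at i 1) [x] \<in> GGS - GGS_comm"
    using separating_generator[OF \<open>x \<noteq> z\<close>] by blast
  have "dir_at i 1 \<in> G" using LG by auto
  then obtain h k where hk: "h \<in> H" "k \<in> level_comm 1" "dir_at i 1 = h + k"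
    using dense unfolding dense_in_def by (metis One_nat_def)
  have k: "fixes_level_one k" "sec k [y] \<in> GGS_comm" for y
    using hk(2) by (simp_all add: fixes_level_one_def)
  have "h = dir_at i 1 - k" using hk(3) by (simp add: algebra_simps)
  moreover have bf: "fixes_level_one (dir_at i 1)" by (simp add: fixes_level_one_def act_fix)
  ultimately have hf: "fixes_level_one h" and hs: "sec h [y] = sec (dir_at i 1) [y] - sec k [y]" for y
    using k(1) by (simp_all only: fixes_level_one_closed sec_minus_one)
  have hz: "sec h [z] \<in> GGS_comm" using hs[of z] i(1) k(2) comm_closed(3) by simp
  have hx: "sec h [x] \<notin> GGS_comm"
  proof
    assume "sec h [x] \<in> GGS_comm"
    then have "sec h [x] + sec k [x] \<in> GGS_comm" using k(2) comm_closed(2) by blast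
    then show False using i(2) unfolding hs by (simp add: add.assoc)
  qed
  define P where "P = {sec d [z] | d. d \<in> H \<and> fixes_level_one d \<and> sec d [x] \<in> GGS_comm}"
  have PI: "sec d [z] \<in> P" if "d \<in> H" "fixes_level_one d" "sec d [x] \<in> GGS_comm" for d
    using that unfolding P_def by blast
  have secL: "sec d [y] \<in> GGS" if "d \<in> H" "fixes_level_one d" for d y
    using sections_offI[of d H "{}" y] that full by auto
  have ex: "\<exists>d\<in>H. fixes_level_one d \<and> sec d [z] = l" if "l \<in> GGS" for l
    using that full[of z] by (metis sections_offE)
  have "GGS_comm \<subseteq> P"
  proof (rule comm_least)
    show "is_subgroup P"
    proof (rule is_subgroupI)
      show "0 \<in> P" using PI[of 0] HD(1) comm_closed(1) fixes_level_one_closed(1) by simp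
      show "a + b \<in> P" if ab: "a \<in> P" "b \<in> P" for a b
      proof -
        obtain d where d: "d \<in> H" "fixes_level_one d" "sec d [x] \<in> GGS_comm" "a = sec d [z]"
          using ab(1) unfolding P_def by blast
        obtain e where e: "e \<in> H" "fixes_level_one e" "sec e [x] \<in> GGS_comm" "b = sec e [z]"
          using ab(2) unfolding P_def by blast
        show ?thesis using PI[of "d + e"] d e HD(2) comm_closed(2) fixes_level_one_closed(2) by simp
      qed
      show "- a \<in> P" if a: "a \<in> P" for a
      proof -
        obtain d where d: "d \<in> H" "fixes_level_one d" "sec d [x] \<in> GGS_comm" "a = sec d [z]"
          using a unfolding P_def by blast
        show ?thesis
          using PI[of "- d"] d HD(3) comm_closed(3) fixes_level_one_closed(3) by (simp add: sec_uminus_one)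
      qed
    qed
    show "normalised_by P GGS"
      unfolding normalised_by_def
    proof (intro ballI)
      fix l a assume l: "l \<in> GGS" and a: "a \<in> P"
      obtain d where d: "d \<in> H" "fixes_level_one d" "sec d [x] \<in> GGS_comm" "a = sec d [z]"
        using a unfolding P_def by blast
      obtain e where e: "e \<in> H" "fixes_level_one e" "sec e [z] = l" using ex[OF l] by blast
      have "sec (e + d - e) [x] \<in> GGS_comm"
        using normalised_byD[OF comm_normal secL[OF e(1,2)] d(3)] d e by (simp add: sec_conj_one)
      then have "sec (e + d - e) [z] \<in> P" using PI d e HD fixes_level_one_closed by simp
      then show "l + a - l \<in> P" using d e by (simp add: sec_conj_one)
    qed
    show "dir c + rot d - dir c - rot d \<in> P" for c d
    proof -
      obtain e where e: "e \<in> H" "fixes_level_one e" "sec e [z] = dir c" using ex[OF dir_GGS] by blast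
      obtain f where f: "f \<in> H" "fixes_level_one f" "sec f [z] = rot d" using ex[OF rot_GGS] by blast
      have "sec (e + f - e - f) [x] \<in> GGS_comm"
        using commutator_comm[OF secL[OF e(1,2)] secL[OF f(1,2)]] e f by (simp add: sec_comm_one)
      then have "sec (e + f - e - f) [z] \<in> P" using PI e f HD fixes_level_one_closed by simp
      then show ?thesis using e f by (simp add: sec_comm_one)
    qed
  qed
  then obtain d where d: "d \<in> H" "fixes_level_one d" "sec d [x] \<in> GGS_comm" "sec h [z] = sec d [z]"
    using hz unfolding P_def by blast
  have "sec (h - d) [x] \<in> sections_off H {z} x"
    by (rule sections_offI) (use d hk(1) hf HD in \<open>simp_all add: fixes_level_one_closed sec_minus_one\<close>)
  moreover have "sec (h - d) [x] \<noteq> 0"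
    using d hx hf by (auto simp: sec_minus_one)
  ultimately show ?thesis by blast
qed

text \<open>A commutator vanishes at a letter as soon as one of its entries does, so commutators of elements trivial on \<open>Z\<close>
with elements trivial at \<open>z\<close> are trivial on both.\<close>
lemma sections_off_nontrivial:
  assumes H: "is_subgroup H" and dense: "dense_in H G" and LG: "GGS \<subseteq> G"
    and full: "\<And>x. sections_off H {} x = GGS" and "finite Z" "x \<notin> Z"
  shows "sections_off H Z x \<noteq> {0}"
  using assms(5,6)
proof (induction rule: finite_induct)
  case empty
  have "dir 1 \<in> GGS" "dir 1 \<noteq> 0" using dexp_dir[of 1] by (auto simp del: dexp_dir)
  then show ?case unfolding full by blast
next
  case (insert z Z)
  note HD = is_subgroupD[OF H]
  have nrm: "normalised_by (sections_off H Z' x) GGS" for Z'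
    using sections_off_normal[OF H, of Z' x] by (simp add: full)
  have "sections_off H Z x \<noteq> {0}" "sections_off H {z} x \<noteq> {0}"
    using insert sections_off_nontrivial_pair[OF H dense LG full, of x z] by auto
  then obtain a b where ab: "a \<in> sections_off H Z x" "b \<in> sections_off H {z} x" "a + b \<noteq> b + a"
    using nontrivial_normal_not_commuting sections_off_subgroup[OF H] nrm by metis
  obtain d where d: "d \<in> H" "fixes_level_one d" "\<And>z. z \<in> Z \<Longrightarrow> sec d [z] = 0" "a = sec d [x]"
    using ab(1) by (rule sections_offE) blast
  obtain e where e: "e \<in> H" "fixes_level_one e" "sec e [z] = 0" "b = sec e [x]"
    using ab(2) by (rule sections_offE) blast
  have "sec (d + e - d - e) [x] \<in> sections_off H (insert z Z) x"
    by (rule sections_offI) (use d e HD in \<open>auto simp: fixes_level_one_closed sec_comm_one\<close>)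
  moreover have "sec (d + e - d - e) [x] \<noteq> 0"
  proof
    assume "sec (d + e - d - e) [x] = 0"
    then have "a + b - a - b = 0" using d e by (simp add: sec_comm_one)
    then have "a + b = b + a" by (simp add: algebra_simps)
    then show False using ab(3) by simp
  qed
  ultimately show ?case by blast
qed

text \<open>This is the step up the tree: the elements of \<open>H\<close> supported below one letter form a non-trivial normal subgroup of
\<open>GGS\<close> and hence contain a layer product, which density then enlarges to all of \<open>G\<close>. It is used with both \<open>GGS\<close> and the wreath
product in the role of \<open>G\<close>.\<close>
lemma dense_full_sections:
  assumes H: "is_subgroup H" and dense: "dense_in H G" and LG: "GGS \<subseteq> G"
    and full: "\<And>x. sections_off H {} x = GGS"
  shows "G \<subseteq> H"
proof -
  note HD = is_subgroupD[OF H]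
  have "\<exists>n. level_comm n \<subseteq> sections_off H (- {x}) x" for x
  proof (rule nontrivial_normal_contains_level)
    show "is_subgroup (sections_off H (- {x}) x)" by (rule sections_off_subgroup[OF H])
    show "normalised_by (sections_off H (- {x}) x) GGS"
      using sections_off_normal[OF H, of "- {x}" x] by (simp add: full)
    show "sections_off H (- {x}) x \<noteq> {0}"
      by (rule sections_off_nontrivial[OF H dense LG full]) simp_all
  qed
  then obtain m where m: "\<And>x. level_comm (m x) \<subseteq> sections_off H (- {x}) x" by metis
  define M where "M = Max (range m)"
  have "level_comm M \<subseteq> level_comm (m x)" for x
    by (rule level_antimono) (simp add: M_def)
  then have M: "level_comm M \<subseteq> sections_off H (- {x}) x" for x using m by blast
  have at: "at_vertex [x] k \<in> H" if k: "k \<in> level_comm M" for x k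
  proof -
    have "k \<in> sections_off H (- {x}) x" using k M by blast
    then obtain d where d: "d \<in> H" "fixes_level_one d" "\<And>z. z \<in> - {x} \<Longrightarrow> sec d [z] = 0" "k = sec d [x]"
      by (rule sections_offE) blast
    have "at_vertex [x] k = d" by (rule level_one_eqI) (use d in auto)
    then show ?thesis using d by simp
  qed
  have M': "level_comm (Suc M) \<subseteq> H"
  proof
    fix g assume g: "g \<in> level_comm (Suc M)"
    show "g \<in> H" by (rule subgroup_contains_parts[OF H]) (use g at in auto)
  qed
  show ?thesis
  proof
    fix g assume "g \<in> G"
    then obtain h k where "h \<in> H" "k \<in> level_comm (Suc M)" "g = h + k"
      using dense unfolding dense_in_def by metis
    then show "g \<in> H" using HD(2) subsetD[OF M'] by simp
  qed
qed

section \<open>Contraction to the generators\<close>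

definition dense_subgroup :: "7 taut set \<Rightarrow> bool" where
  "dense_subgroup H \<longleftrightarrow> is_subgroup H \<and> H \<subseteq> GGS \<and> dense_in H GGS"

lemma level_Suc_fixes: "k \<in> level_comm (Suc n) \<Longrightarrow> fixes_level_one k \<and> sec k [x] \<in> level_comm n"
  by (simp add: fixes_level_one_def)

text \<open>An approximation of \<open>g\<close> by \<open>H\<close> one layer deeper than needed restricts to an approximation of the section of \<open>g\<close>.\<close>
lemma dense_in_sections_off:
  assumes dense: "dense_in H G" and rep: "\<And>l. l \<in> GGS \<Longrightarrow> \<exists>g\<in>G. fixes_level_one g \<and> sec g [x] = l"
  shows "dense_in (sections_off H {} x) GGS"
  unfolding dense_in_def
proof (intro allI ballI)
  fix n l assume "l \<in> GGS"
  then obtain g where g: "g \<in> G" "fixes_level_one g" "sec g [x] = l" using rep by blast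
  obtain h k where hk: "h \<in> H" "k \<in> level_comm (Suc (Suc n))" "g = h + k"
    using dense g(1) unfolding dense_in_def by metis
  have k: "fixes_level_one k" "sec k [x] \<in> level_comm (Suc n)" using level_Suc_fixes[OF hk(2)] by blast+
  have "h = g - k" using hk(3) by (simp add: algebra_simps)
  then have "fixes_level_one h" using fixes_level_one_closed(4)[OF g(2) k(1)] by simp
  then have "sec h [x] \<in> sections_off H {} x" using sections_offI[of h H "{}" x] hk(1) by simp
  moreover have "l = sec h [x] + sec k [x]" using g(3) hk(3) k(1) by simp
  ultimately show "\<exists>h\<in>sections_off H {} x. \<exists>k\<in>level_comm (Suc n). l = h + k" using k(2) by blast
qed

lemma fixes_one_GGS: "h \<in> GGS \<Longrightarrow> fixes_level_one h \<longleftrightarrow> root_shift h = 0"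
  by (simp add: fixes_level_one_def act_GGS)

lemma self_replicating_fixes: "l \<in> GGS \<Longrightarrow> \<exists>g\<in>GGS. fixes_level_one g \<and> sec g [x] = l"
  using self_replicating_one fixes_one_GGS by blast

lemma dense_subgroup_sections_off:
  assumes "dense_subgroup H" shows "dense_subgroup (sections_off H {} x)"
proof -
  have H: "is_subgroup H" "H \<subseteq> GGS" "dense_in H GGS" using assms by (auto simp: dense_subgroup_def)
  have "sections_off H {} x \<subseteq> GGS" using H(2) sec_GGS unfolding sections_off_def by blast
  then show ?thesis
    using sections_off_subgroup[OF H(1)] dense_in_sections_off[OF H(3) self_replicating_fixes] by (simp add: dense_subgroup_def)
qed

definition conj_by :: "7 taut \<Rightarrow> 7 taut set \<Rightarrow> 7 taut set" where
  "conj_by g H = {- g + h + g | h. h \<in> H}"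

lemma conj_byI: "h \<in> H \<Longrightarrow> a = - g + h + g \<Longrightarrow> a \<in> conj_by g H"
  unfolding conj_by_def by blast

lemma conj_by_iff: "a \<in> conj_by g H \<longleftrightarrow> g + a - g \<in> H"
proof
  assume "a \<in> conj_by g H"
  then obtain h where "h \<in> H" "a = - g + h + g" unfolding conj_by_def by blast
  then show "g + a - g \<in> H" by (simp only: group_word)
next
  assume "g + a - g \<in> H"
  then show "a \<in> conj_by g H" by (rule conj_byI) (simp only: group_word)
qed

lemma dense_subgroup_conj_by:
  assumes "dense_subgroup H" "g \<in> GGS" shows "dense_subgroup (conj_by g H)"
proof -
  have H: "is_subgroup H" "H \<subseteq> GGS" "dense_in H GGS" using assms by (auto simp: dense_subgroup_def)
  note HD = is_subgroupD[OF H(1)]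
  have "is_subgroup (conj_by g H)"
  proof (rule is_subgroupI)
    show "0 \<in> conj_by g H" using HD(1) by (simp add: conj_by_iff)
    show "a + b \<in> conj_by g H" if ab: "a \<in> conj_by g H" "b \<in> conj_by g H" for a b
    proof -
      have "(g + a - g) + (g + b - g) \<in> H" using ab HD(2) unfolding conj_by_iff by blast
      then show ?thesis unfolding conj_by_iff by (simp only: group_word)
    qed
    show "- a \<in> conj_by g H" if a: "a \<in> conj_by g H" for a
    proof -
      have "- (g + a - g) \<in> H" using a HD(3) unfolding conj_by_iff by blast
      then show ?thesis unfolding conj_by_iff by (simp only: group_word)
    qed
  qed
  moreover have "conj_by g H \<subseteq> GGS"
  proof
    fix a assume "a \<in> conj_by g H"
    then obtain h where "h \<in> H" "a = - g + h + g" unfolding conj_by_def by blast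
    then show "a \<in> GGS" using subsetD[OF H(2)] assms(2) by (simp add: GGS_closed)
  qed
  moreover have "dense_in (conj_by g H) GGS"
    unfolding dense_in_def
  proof (intro allI ballI)
    fix n l assume l: "l \<in> GGS"
    then have "g + l - g \<in> GGS" using assms(2) by (simp add: GGS_closed)
    then obtain h k where hk: "h \<in> H" "k \<in> level_comm (Suc n)" "g + l - g = h + k"
      using H(3) unfolding dense_in_def by metis
    have "l = - g + (g + l - g) + g" by (simp only: group_word)
    also have "\<dots> = (- g + h + g) + (- g + k - - g)" unfolding hk(3) by (simp only: group_word)
    finally have e: "l = (- g + h + g) + (- g + k - - g)" .
    have "- g + h + g \<in> conj_by g H" using conj_byI[OF hk(1) refl] .
    moreover have "- g + k - - g \<in> level_comm (Suc n)"
      using normalised_byD[OF level_normal GGS_closed(3)[OF assms(2)] hk(2)] .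
    ultimately show "\<exists>h\<in>conj_by g H. \<exists>k\<in>level_comm (Suc n). l = h + k" using e by blast
  qed
  ultimately show ?thesis by (simp add: dense_subgroup_def)
qed

lemma dense_subgroup_root_shift:
  assumes "dense_subgroup H" shows "\<exists>h\<in>H. root_shift h = c"
proof -
  obtain h k where hk: "h \<in> H" "k \<in> level_comm (Suc 0)" "rot c = h + k"
    using assms rot_GGS unfolding dense_subgroup_def dense_in_def by metis
  have "k \<in> GGS_comm" using hk(2) level_subset_comm by blast
  then have "root_shift h + root_shift k = c" "root_shift k = 0"
    using hk assms shift_plus[of h k] comm_subset_GGS by (auto simp: dense_subgroup_def GGS_comm_def simp flip: hk(3))
  then show ?thesis using hk(1) by auto
qed

text \<open>Some iterated section group of a conjugate of \<open>H\<close> is everything. Conjugations are allowed at each stage because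
the contraction finds the rotations only up to conjugacy; for the conclusion \<open>H = GGS\<close> they are harmless.\<close>
inductive descends_to_GGS :: "7 taut set \<Rightarrow> bool" where
  descends_all: "GGS \<subseteq> H \<Longrightarrow> descends_to_GGS H"
| descends_sections_off: "descends_to_GGS (sections_off H {} x) \<Longrightarrow> descends_to_GGS H"
| descends_conj_by: "g \<in> GGS \<Longrightarrow> descends_to_GGS (conj_by g H) \<Longrightarrow> descends_to_GGS H"

lemma descends_imp_eq_GGS: "descends_to_GGS H \<Longrightarrow> dense_subgroup H \<Longrightarrow> H = GGS"
proof (induction rule: descends_to_GGS.induct)
  case (descends_all H)
  then show ?case by (auto simp: dense_subgroup_def)
next
  case (descends_sections_off H x)
  have H: "is_subgroup H" "H \<subseteq> GGS" "dense_in H GGS" using descends_sections_off.prems by (auto simp: dense_subgroup_def)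
  note HD = is_subgroupD[OF H(1)]
  have x: "sections_off H {} x = GGS" using descends_sections_off dense_subgroup_sections_off by blast
  have full: "sections_off H {} y = GGS" for y
  proof
    show "sections_off H {} y \<subseteq> GGS" using dense_subgroup_sections_off[OF descends_sections_off.prems] by (simp add: dense_subgroup_def)
    show "GGS \<subseteq> sections_off H {} y"
    proof
      fix l assume l: "l \<in> GGS"
      obtain h where h: "h \<in> H" "root_shift h = y - x" using dense_subgroup_root_shift[OF descends_sections_off.prems] by blast
      then have hL: "h \<in> GGS" using H(2) by blast
      have hy: "act h [x] = [y]" using act_GGS[OF hL] h(2) by simp
      let ?s = "sec h [x]"
      have "- ?s + l + ?s \<in> GGS" using l sec_GGS[OF hL] by (simp add: GGS_closed)
      then obtain d where d: "d \<in> H" "fixes_level_one d" "- ?s + l + ?s = sec d [x]"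
        using x by (metis sections_offE)
      have "sec (h + d - h) (act h [x]) = ?s + (- ?s + l + ?s) - ?s"
        unfolding sec_conj d(3) using d(2) by simp
      also have "\<dots> = l" by (simp only: group_word)
      finally have "sec (h + d - h) [y] = l" unfolding hy .
      moreover have dL: "d \<in> GGS" "root_shift d = 0" using d H(2) fixes_one_GGS by blast+
      then have "fixes_level_one (h + d - h)"
        using hL by (subst fixes_one_GGS) (simp_all add: GGS_closed shift_minus shift_plus)
      ultimately show "l \<in> sections_off H {} y"
        using sections_offI[of "h + d - h" H "{}" y] HD d(1) h(1) by simp
    qed
  qed
  show ?case using dense_full_sections[OF H(1,3) order_refl full] H(2) by blast
next
  case (descends_conj_by g H)
  then have "conj_by g H = GGS" using dense_subgroup_conj_by by blast
  have "GGS \<subseteq> H"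
  proof
    fix l assume "l \<in> GGS"
    then have "- g + l + g \<in> conj_by g H" using \<open>conj_by g H = GGS\<close> descends_conj_by.hyps(1) by (simp add: GGS_closed)
    then have "g + (- g + l + g) - g \<in> H" unfolding conj_by_iff .
    then show "l \<in> H" by (simp only: group_word)
  qed
  then show ?case using descends_conj_by.prems by (auto simp: dense_subgroup_def)
qed

text \<open>The conjugating element \<open>f\<close> may be taken to fix the first layer. The section group at 0 then contains the
conjugate of the directed generators by the section of \<open>f\<close> at 0 and the conjugates of the rotations by the sections of \<open>f\<close> at
1 and at 2. Conjugating the rotations back into standard position replaces \<open>f\<close> by a quotient of two of
its sections. Of the two choices one is shorter, unless all the length of \<open>f\<close> sits at 0; but then \<open>f\<close> is a
power of \<open>dir 1\<close> and commutes with the directed generators.\<close>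
lemma descends_of_conjugate:
  assumes "dense_subgroup H" "\<And>c. rot c \<in> H" "\<And>c. f + dir c - f \<in> H" "word_rep f e n"
  shows "descends_to_GGS H"
  using assms
proof (induction n arbitrary: H f e rule: less_induct)
  case (less n)
  have H: "is_subgroup H" "H \<subseteq> GGS" "dense_in H GGS" using less.prems(1) by (auto simp: dense_subgroup_def)
  note HD = is_subgroupD[OF H(1)]
  define f' where "f' = rot (- root_shift f) + f"
  have Rf: "word_rep f' e n" using word_rot[OF less.prems(4)] by (simp add: f'_def)
  have fL: "f \<in> GGS" "f' \<in> GGS" using less.prems(4) Rf by (auto simp: GGS_def)
  have shf: "root_shift f' = 0" using fL by (simp add: f'_def shift_plus)
  have ff: "fixes_level_one f'" using fL shf by (simp add: fixes_one_GGS)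
  define q where "q c = f' + dir c - f'" for c
  have qH: "q c \<in> H" for c
  proof -
    have "rot (- root_shift f) + (f + dir c - f) - rot (- root_shift f) \<in> H" by (simp add: less.prems(2,3) HD)
    then show ?thesis unfolding q_def f'_def by (simp only: group_word)
  qed
  have bf: "fixes_level_one (dir c)" for c by (simp add: fixes_level_one_def)
  have qf: "fixes_level_one (q c)" for c unfolding q_def using ff bf by (simp add: fixes_level_one_closed)
  have qs: "sec (q c) [x] = sec f' [x] + sec (dir c) [x] - sec f' [x]" for c x
    unfolding q_def using ff bf by (rule sec_conj_one)
  have qrot: "sec f' [i] + sec (dir c) [i] - sec f' [i] \<in> sections_off H {} 0" for c i
  proof -
    let ?r = "rot (- i)"
    have rf: "fixes_level_one (?r + q c - ?r)"
    proof -
      have "q c \<in> GGS" "root_shift (q c) = 0" using qH[of c] qf[of c] H(2) fixes_one_GGS by blast+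
      then show ?thesis by (subst fixes_one_GGS) (simp_all add: GGS_closed shift_minus shift_plus)
    qed
    have "sec (?r + q c - ?r) (act ?r [i]) = sec (q c) [i]"
      unfolding sec_conj using qf[of c] by simp
    then have "sec (?r + q c - ?r) [0] = sec (q c) [i]" by simp
    moreover have "?r + q c - ?r \<in> H" by (simp add: qH less.prems(2) HD)
    ultimately show ?thesis using sections_offI[OF _ rf, of H "{}" 0] qs by simp
  qed
  obtain es ns where sn: "\<And>x. word_rep (sec f' [x]) (es x) (ns x)" "(\<Sum>x\<in>UNIV. ns x) = n"
     "\<And>x. ns x = n \<Longrightarrow> \<exists>c. f' = rot c + dir e - rot x"
    using word_sections[OF Rf] by blast
  have step: "descends_to_GGS H" if lt: "ns i + ns 0 < n" and rc: "\<And>c. sec f' [i] + rot c - sec f' [i] \<in> sections_off H {} 0" for i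
  proof -
    let ?s = "sec f' [i]"
    have sL: "?s \<in> GGS" using fL sec_GGS by blast
    have "descends_to_GGS (conj_by ?s (sections_off H {} 0))"
    proof (rule less.IH[OF lt])
      show "dense_subgroup (conj_by ?s (sections_off H {} 0))" using dense_subgroup_conj_by dense_subgroup_sections_off less.prems(1) sL by blast
      show "rot c \<in> conj_by ?s (sections_off H {} 0)" for c unfolding conj_by_iff using rc .
      have "sec f' [0] + dir c - sec f' [0] \<in> sections_off H {} 0" for c using qrot[of 0 c] by simp
      then show "(- ?s + sec f' [0]) + dir c - (- ?s + sec f' [0]) \<in> conj_by ?s (sections_off H {} 0)" for c
        unfolding conj_by_iff by (simp only: group_word)
      show "word_rep (- ?s + sec f' [0]) (- es i + es 0) (ns i + ns 0)"
        using word_append[OF word_uminus[OF sn(1)] sn(1)] .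
    qed
    then show ?thesis using descends_conj_by[OF sL] descends_sections_off by blast
  qed
  consider "ns 1 + ns 0 < n" | "ns 2 + ns 0 < n" | "ns 0 = n"
    using sn(2) unfolding sum7 by linarith
  then show ?case
  proof cases
    case 1
    then show ?thesis using step qrot[of 1] by simp
  next
    case 2
    have "sec f' [2] + rot c - sec f' [2] \<in> sections_off H {} 0" for c using qrot[of 2 "- c"] by simp
    then show ?thesis using step[OF 2] by blast
  next
    case 3
    then obtain c where c: "f' = rot c + dir e" using sn(3)[of 0] by auto
    then have "c = 0" using shf by (simp add: shift_plus)
    then have f': "f' = dir e" using c by simp
    have "dir c \<in> H" for c
    proof -
      have "dir e + dir c = dir c + dir e" using dir_plus[of e c] dir_plus[of c e] add.commute[of e c] by simp
      then have "q c = dir c" unfolding q_def f' by simp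
      then show ?thesis using qH[of c] by simp
    qed
    then have "GGS \<subseteq> H" using GGS_induct[OF _ H(1)] less.prems(2) by blast
    then show ?thesis by (rule descends_all)
  qed
qed

text \<open>The rotation at the letter 1 in \<open>dir c\<close> is brought to the letter 0 by an element of \<open>H\<close>, at the cost of a
conjugation.\<close>
lemma descends_of_dir:
  assumes "dense_subgroup H" "\<And>c. dir c \<in> H" shows "descends_to_GGS H"
proof -
  have H: "is_subgroup H" "H \<subseteq> GGS" "dense_in H GGS" using assms(1) by (auto simp: dense_subgroup_def)
  note HD = is_subgroupD[OF H(1)]
  obtain h where h: "h \<in> H" "root_shift h = - 1" using dense_subgroup_root_shift[OF assms(1)] by blast
  have hL: "h \<in> GGS" using h H by blast
  let ?g = "sec h [1]"
  have gL: "?g \<in> GGS" using sec_GGS[OF hL] .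
  then have "- ?g \<in> GGS" by (rule GGS_closed(3))
  then obtain e n where wr: "word_rep (- ?g) e n" by (auto simp: GGS_def)
  have "descends_to_GGS (conj_by ?g (sections_off H {} 0))"
  proof (rule descends_of_conjugate[OF _ _ _ wr])
    show "dense_subgroup (conj_by ?g (sections_off H {} 0))" using dense_subgroup_conj_by dense_subgroup_sections_off assms(1) gL by blast
    show "rot c \<in> conj_by ?g (sections_off H {} 0)" for c
    proof -
      have "fixes_level_one (h + dir c - h)"
        using hL by (subst fixes_one_GGS) (simp_all add: GGS_closed shift_minus shift_plus)
      moreover have "h + dir c - h \<in> H" by (simp add: h assms(2) HD)
      ultimately have "sec (h + dir c - h) [0] \<in> sections_off H {} 0" using sections_offI by blast
      moreover have "sec (h + dir c - h) (act h [1]) = ?g + rot c - ?g"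
        unfolding sec_conj by simp
      moreover have "act h [1] = [0]" using act_GGS[OF hL] h(2) by simp
      ultimately show ?thesis unfolding conj_by_iff by simp
    qed
    show "- ?g + dir c - - ?g \<in> conj_by ?g (sections_off H {} 0)" for c
    proof -
      have "sec (dir c) [0] \<in> sections_off H {} 0" by (rule sections_offI) (simp_all add: assms(2) fixes_level_one_def)
      then have "?g + (- ?g + dir c - - ?g) - ?g \<in> sections_off H {} 0" by (simp only: group_word) simp
      then show ?thesis unfolding conj_by_iff .
    qed
  qed
  then show ?thesis using descends_conj_by[OF gL] descends_sections_off by blast
qed

primrec multiple :: "7 taut \<Rightarrow> nat \<Rightarrow> 7 taut" where
  "multiple h 0 = 0"
| "multiple h (Suc k) = h + multiple h k"

text \<open>If \<open>h\<close> fixes the first layer, a section with non-zero exponent is shorter, or else carries all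
syllables of \<open>h\<close>, which makes it a power of \<open>dir 1\<close>. If \<open>h\<close> rotates the letters, the section of its seventh power at 0 is the
product of all seven sections of \<open>h\<close>: it has the same exponent and length as \<open>h\<close>, and its own rotation is the sum of the rotations of the sections, which is
zero. So the first case applies to it.\<close>
lemma descends_of_dexp:
  assumes "dense_subgroup H" "h \<in> H" "word_rep h e n" "e \<noteq> 0"
  shows "descends_to_GGS H"
  using assms
proof (induction n arbitrary: H h e rule: less_induct)
  case (less n)
  have fixing: "descends_to_GGS H" if D: "dense_subgroup H" and h: "h \<in> H" "word_rep h e n" "e \<noteq> 0" "root_shift h = 0" for H h e
  proof -
    have H: "is_subgroup H" "H \<subseteq> GGS" using D by (auto simp: dense_subgroup_def)
    have hf: "fixes_level_one h" using h H fixes_one_GGS by blast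
    obtain es ns where sn: "\<And>x. word_rep (sec h [x]) (es x) (ns x)" "(\<Sum>x\<in>UNIV. es x) = e"
      "(\<Sum>x\<in>UNIV. ns x) = n" "\<And>x. ns x = n \<Longrightarrow> \<exists>c. h = rot c + dir e - rot x"
      using word_sections[OF h(2)] by blast
    obtain x where x: "es x \<noteq> 0"
      using sn(2) \<open>e \<noteq> 0\<close> by (metis sum.neutral)
    have hx: "sec h [x] \<in> sections_off H {} x" using sections_offI[OF h(1) hf, of "{}" x] by simp
    have "ns x \<le> n" using sn(3) member_le_sum[of x UNIV ns] by simp
    then consider "ns x < n" | "ns x = n" by linarith
    then have "descends_to_GGS (sections_off H {} x)"
    proof cases
      case 1
      then show ?thesis using less.IH[OF 1 dense_subgroup_sections_off[OF D] hx sn(1) x] by blast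
    next
      case 2
      then obtain c where c: "h = rot c + dir e - rot x" using sn(4) by blast
      then have "c = x" using h(4) by (simp add: shift_plus shift_minus GGS_closed)
      then have "h = dir_at x e" using c by (simp add: dir_at_def)
      then have be: "dir e \<in> sections_off H {} x" using hx by simp
      note ND = is_subgroupD[OF sections_off_subgroup[OF H(1), of "{}" x]]
      have "d \<in> {d. dir d \<in> sections_off H {} x}" for d
        by (rule generates7[OF \<open>e \<noteq> 0\<close>]) (use be ND in \<open>auto simp: dir_plus\<close>)
      then show ?thesis using descends_of_dir[OF dense_subgroup_sections_off[OF D]] by blast
    qed
    then show ?thesis by (rule descends_sections_off)
  qed
  show ?case
  proof (cases "root_shift h = 0")
    case True
    then show ?thesis using fixing less.prems by blast
  next
    case False
    let ?c = "root_shift h"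
    have H: "is_subgroup H" "H \<subseteq> GGS" using less.prems by (auto simp: dense_subgroup_def)
    note HD = is_subgroupD[OF H(1)]
    have hL: "h \<in> GGS" using less.prems H by blast
    obtain es ns where sn: "\<And>x. word_rep (sec h [x]) (es x) (ns x)" "(\<Sum>x\<in>UNIV. es x) = e"
      "(\<Sum>x\<in>UNIV. ns x) = n" "(\<Sum>x\<in>UNIV. root_shift (sec h [x])) = 0"
      using word_sections[OF less.prems(3)] by blast
    have P: "multiple h k \<in> H \<and> root_shift (multiple h k) = of_nat k * ?c \<and>
        word_rep (sec (multiple h k) [0]) (\<Sum>j<k. es (of_nat j * ?c)) (\<Sum>j<k. ns (of_nat j * ?c)) \<and>
        root_shift (sec (multiple h k) [0]) = (\<Sum>j<k. root_shift (sec h [of_nat j * ?c]))" for k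
    proof (induction k)
      case 0
      then show ?case using HD(1) word_zero by simp
    next
      case (Suc k)
      then have kL: "multiple h k \<in> GGS" using H by blast
      have s: "sec (multiple h (Suc k)) [0] = sec h [of_nat k * ?c] + sec (multiple h k) [0]"
        using Suc act_GGS[OF kL, of 0] by simp
      have "root_shift (multiple h (Suc k)) = of_nat (Suc k) * ?c"
        using Suc kL hL by (simp add: shift_plus distrib_right)
      moreover have "word_rep (sec (multiple h (Suc k)) [0]) (\<Sum>j<Suc k. es (of_nat j * ?c)) (\<Sum>j<Suc k. ns (of_nat j * ?c))"
        unfolding s using word_append[OF sn(1)[of "of_nat k * ?c"] conjunct1[OF conjunct2[OF conjunct2[OF Suc]]]]
        by (simp add: add.commute)
      moreover have "root_shift (sec (multiple h (Suc k)) [0]) = (\<Sum>j<Suc k. root_shift (sec h [of_nat j * ?c]))"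
        unfolding s using Suc shift_plus[OF sec_GGS[OF hL] sec_GGS[OF kL]] by (simp add: add.commute)
      ultimately show ?case using Suc HD(2) less.prems(2) by simp
    qed
    have "(7 :: 7) = 0" by simp
    then have z: "7 * ?c = 0" by (metis mult_zero_left)
    have sz: "(\<Sum>j<7. root_shift (sec h [of_nat j * ?c])) = 0"
      using sum_multiples7[OF False, of "\<lambda>x. root_shift (sec h [x])"] sn(4) by simp
    have p7: "multiple h 7 \<in> H" "root_shift (multiple h 7) = 0" "word_rep (sec (multiple h 7) [0]) e n" "root_shift (sec (multiple h 7) [0]) = 0"
      using P[of 7] sn(2,3) z sz unfolding sum_multiples7[OF False, of es] sum_multiples7[OF False, of ns]
      by simp_all
    then have "fixes_level_one (multiple h 7)" using H fixes_one_GGS by blast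
    then have "sec (multiple h 7) [0] \<in> sections_off H {} 0" using sections_offI[OF p7(1), of "{}" 0] by simp
    then have "descends_to_GGS (sections_off H {} 0)"
      using fixing[OF dense_subgroup_sections_off[OF less.prems(1)] _ p7(3) less.prems(4) p7(4)] by blast
    then show ?thesis by (rule descends_sections_off)
  qed
qed

theorem dense_subgroup_eq_GGS: "dense_subgroup H \<Longrightarrow> H = GGS"
proof (rule descends_imp_eq_GGS)
  assume D: "dense_subgroup H"
  obtain h k where hk: "h \<in> H" "k \<in> level_comm (Suc 0)" "dir 1 = h + k"
    using D dir_GGS unfolding dense_subgroup_def dense_in_def by metis
  have "k \<in> GGS_comm" using hk(2) level_subset_comm by blast
  moreover have "h \<in> GGS" using hk D by (auto simp: dense_subgroup_def)
  ultimately have "dir_exp h = 1" using dexp_plus[of h k] by (simp add: GGS_comm_def flip: hk(3))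
  obtain e n where wr: "word_rep h e n" using \<open>h \<in> GGS\<close> by (auto simp: GGS_def)
  have "e \<noteq> 0" using word_dexp[OF wr] \<open>dir_exp h = 1\<close> by simp
  then show "descends_to_GGS H" using descends_of_dexp[OF D hk(1) wr] by blast
qed

text \<open>In the wreath product the sections are unrestricted, so the section groups of \<open>H\<close> are dense in \<open>GGS\<close> and hence equal to it.\<close>
theorem dense_in_wreath_eq:
  assumes H: "is_subgroup H" "H \<subseteq> GGS_wreath" and dense: "dense_in H GGS_wreath"
  shows "H = GGS_wreath"
proof -
  have "sections_off H {} x = GGS" for x
  proof (rule dense_subgroup_eq_GGS)
    have "sections_off H {} x \<subseteq> GGS" using H(2) unfolding sections_off_def GGS_wreath_def by blast
    moreover have "dense_in (sections_off H {} x) GGS"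
    proof (rule dense_in_sections_off[OF dense])
      fix l assume "l \<in> GGS"
      then have "at_vertex [x] l \<in> GGS_wreath" using GGS_closed(1) by (simp add: GGS_wreath_def)
      then show "\<exists>g\<in>GGS_wreath. fixes_level_one g \<and> sec g [x] = l"
        by (rule bexI[rotated]) (simp add: fixes_level_one_def)
    qed
    ultimately show "dense_subgroup (sections_off H {} x)" using sections_off_subgroup[OF H(1)] by (simp add: dense_subgroup_def)
  qed
  then show ?thesis using dense_full_sections[OF H(1) dense GGS_subset_wreath] H(2) by blast
qed

section \<open>The wreath product as a branch group\<close>

text \<open>Modulo \<open>level_comm (Suc n)\<close> an element is determined by its permutation of the letters and by its sections
modulo \<open>level_comm n\<close>.\<close>
lemma finite_cover_step:
  assumes "\<exists>F. finite F \<and> (\<forall>g\<in>GGS. \<exists>f\<in>F. g - f \<in> level_comm n)"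
  shows "\<exists>F. finite F \<and> (\<forall>g\<in>GGS_wreath. \<exists>f\<in>F. g - f \<in> level_comm (Suc n))"
proof -
  obtain F where F: "finite F" "\<And>g. g \<in> GGS \<Longrightarrow> \<exists>f\<in>F. g - f \<in> level_comm n" using assms by blast
  let ?F = "(\<lambda>(s, f). node s f) ` (UNIV \<times> PiE UNIV (\<lambda>_. F))"
  have "finite ?F" using F(1) by (intro finite_imageI finite_cartesian_product finite_PiE) simp_all
  moreover have "\<exists>f\<in>?F. g - f \<in> level_comm (Suc n)" if g: "g \<in> GGS_wreath" for g
  proof -
    obtain s where s: "\<And>x. act g [x] = [s x]" using act_single[of g] by metis
    have "inj s"
    proof (rule injI)
      fix x y assume "s x = s y"
      then have "act g [x] = act g [y]" by (simp add: s)
      then show "x = y" by simp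
    qed
    then have bs: "bij s" by (simp add: bij_def finite_UNIV_inj_surj)
    have "\<forall>x. \<exists>f\<in>F. sec g [x] - f \<in> level_comm n" using g F(2) by (simp add: GGS_wreath_def)
    then obtain f where f: "\<And>x. f x \<in> F" "\<And>x. sec g [x] - f x \<in> level_comm n" by metis
    let ?f = "node s f"
    have "act (g - ?f) [y] = [y] \<and> sec (g - ?f) [y] \<in> level_comm n" for y
    proof -
      obtain x where x: "act (- ?f) [y] = [x]" using act_single[of "- ?f" y] by blast
      then have "act ?f [x] = [y]" by (metis act_act_uminus(1))
      then have "s x = y" using bs by (simp add: act_node)
      then show ?thesis using f(2)[of x] x s[of x] bs
        by (simp only: diff_conv_add_uminus act_plus sec_plus sec_uminus sec_node)
    qed
    then have "g - ?f \<in> level_comm (Suc n)" by simp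
    moreover have "?f \<in> ?F" using f(1) by (intro image_eqI[of _ _ "(s, f)"]) auto
    ultimately show ?thesis by blast
  qed
  ultimately show ?thesis by blast
qed

lemma finite_cover_GGS: "\<exists>F. finite F \<and> (\<forall>g\<in>GGS. \<exists>f\<in>F. g - f \<in> level_comm n)"
proof (induction n)
  case 0
  let ?F = "(\<lambda>(s, e). rot s + dir e) ` UNIV"
  have "g - (rot (root_shift g) + dir (dir_exp g)) \<in> level_comm 0" if "g \<in> GGS" for g
    using that by (simp add: GGS_comm_def shift_minus shift_plus dexp_minus dexp_plus GGS_closed)
  moreover have "rot (root_shift g) + dir (dir_exp g) \<in> ?F" for g by (rule image_eqI[of _ _ "(root_shift g, dir_exp g)"]) auto
  ultimately show ?case by (intro exI[of _ ?F]) auto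
next
  case (Suc n)
  obtain F where "finite F" "\<And>g. g \<in> GGS_wreath \<Longrightarrow> \<exists>f\<in>F. g - f \<in> level_comm (Suc n)"
    using finite_cover_step[OF Suc] by auto
  then show ?case using subsetD[OF GGS_subset_wreath] by (intro exI[of _ F]) simp
qed

lemma finite_cover_wreath: "\<exists>F. finite F \<and> (\<forall>g\<in>GGS_wreath. \<exists>f\<in>F. g - f \<in> level_comm (Suc n))"
  by (rule finite_cover_step[OF finite_cover_GGS])

definition letters :: "nat set" where "letters = {1..7}"

definition enc :: "7 \<Rightarrow> nat" where "enc = (SOME e. bij_betw e UNIV letters)"

lemma bij_enc: "bij_betw enc UNIV letters"
proof -
  have "\<exists>e. bij_betw e (UNIV :: 7 set) letters"
    by (rule finite_same_card_bij) (simp_all add: letters_def)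
  then show ?thesis unfolding enc_def by (rule someI_ex)
qed

definition dec :: "nat \<Rightarrow> 7" where "dec = inv_into UNIV enc"

lemma enc_letters [simp]: "enc x \<in> letters" and dec_enc [simp]: "dec (enc x) = x"
  and enc_dec: "y \<in> letters \<Longrightarrow> enc (dec y) = y"
  using bij_enc unfolding dec_def
  by (auto simp: bij_betw_def f_inv_into_f)

lemma enc_eq [simp]: "enc x = enc y \<longleftrightarrow> x = y"
  by (metis dec_enc)

lemma map_enc_letters [simp]: "map enc u \<in> lists letters"
  by (auto simp: in_lists_conv_set)

lemma map_dec_enc [simp]: "map dec (map enc u) = u"
  by (induction u) simp_all

lemma map_enc_dec: "w \<in> lists letters \<Longrightarrow> map enc (map dec w) = w"
  by (induction w) (auto simp: enc_dec)

lemma words_letters: assumes "w \<in> lists letters" obtains u where "w = map enc u"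
  using map_enc_dec[OF assms] by metis

lemma map_enc_eq [simp]: "map enc u = map enc v \<longleftrightarrow> u = v"
  by (metis map_dec_enc)

text \<open>Automorphisms of the tree over the type of integers modulo 7 are carried to the alphabet \<open>{1..7}\<close>, the one on which
the symmetric group of degree 7 acts.\<close>
definition realise :: "7 taut \<Rightarrow> nat list \<Rightarrow> nat list" where
  "realise g = (\<lambda>w\<in>lists letters. map enc (act g (map dec w)))"

lemma realise_enc [simp]: "realise g (map enc u) = map enc (act g u)"
  unfolding realise_def by (simp only: map_enc_letters restrict_apply' map_dec_enc)

lemma realise_ext: "realise g \<in> extensional (lists letters)"
  by (simp add: realise_def)

lemma realise_eqI: "f \<in> extensional (lists letters) \<Longrightarrow> (\<And>u. f (map enc u) = map enc (act g u)) \<Longrightarrow> f = realise g"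
  by (rule extensionalityI[OF _ realise_ext]) (auto elim!: words_letters)

lemma realise_inj [simp]: "realise g = realise h \<longleftrightarrow> g = h"
proof
  assume *: "realise g = realise h"
  have "map enc (act g u) = map enc (act h u)" for u
    using fun_cong[OF *, of "map enc u"] by simp
  then show "g = h" by (intro taut_eqI) simp
qed simp

lemma compose_realise: "compose (lists letters) (realise g) (realise h) = realise (g + h)"
  by (rule realise_eqI) (simp_all add: compose_def del: map_map)

lemma realise_zero: "realise 0 = (\<lambda>w\<in>lists letters. w)"
  by (rule realise_eqI[symmetric]) (simp_all del: map_map)

lemma realise_Bij: "realise g \<in> Bij (lists letters)"
proof -
  have "bij_betw (realise g) (lists letters) (lists letters)"
  proof (rule bij_betw_byWitness[where f' = "realise (- g)"])
    show "\<forall>a\<in>lists letters. realise (- g) (realise g a) = a" by (auto elim!: words_letters)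
    show "\<forall>a\<in>lists letters. realise g (realise (- g) a) = a" by (auto elim!: words_letters)
    show "realise g ` lists letters \<subseteq> lists letters" "realise (- g) ` lists letters \<subseteq> lists letters"
      by (auto elim!: words_letters simp del: in_listsI lists.simps)
  qed
  then show ?thesis by (simp add: Bij_def realise_ext)
qed

lemma realise_adj:
  assumes "tree_adj letters u v" shows "tree_adj letters (realise g u) (realise g v)"
proof -
  have step: "\<exists>z\<in>letters. realise g (w @ [y]) = realise g w @ [z]" if "w \<in> lists letters" "y \<in> letters" for w y
  proof -
    obtain w' where w: "w = map enc w'" using words_letters \<open>w \<in> lists letters\<close> by blast
    have y: "w @ [y] = map enc (w' @ [dec y])" using w enc_dec that by simp
    obtain z where z: "act (sec g w') [dec y] = [z]" using act_single[of "sec g w'" "dec y"] by blast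
    have "realise g (w @ [y]) = map enc (act g w' @ [z])"
      unfolding y by (simp only: realise_enc act_append z)
    also have "\<dots> = realise g w @ [enc z]" unfolding w by simp
    finally show ?thesis by (intro bexI[of _ "enc z"]) simp_all
  qed
  have mem: "realise g w \<in> lists letters" if "w \<in> lists letters" for w
    using Bij_imp_funcset[OF realise_Bij] that by blast
  have uv: "u \<in> lists letters" "v \<in> lists letters" using assms by (simp_all add: tree_adj_def)
  obtain x where x: "x \<in> letters" "v = u @ [x] \<or> u = v @ [x]" using assms by (auto simp: tree_adj_def)
  have "\<exists>z\<in>letters. realise g v = realise g u @ [z] \<or> realise g u = realise g v @ [z]"
    using step[OF uv(1) x(1)] step[OF uv(2) x(1)] x(2) by blast
  then show ?thesis using mem uv by (simp add: tree_adj_def)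
qed

lemma realise_carrier: "realise g \<in> carrier (Aut_tree letters)"
proof -
  have "tree_adj letters u v" if "u \<in> lists letters" "v \<in> lists letters" "tree_adj letters (realise g u) (realise g v)" for u v
  proof -
    have "realise (- g) (realise g w) = w" if "w \<in> lists letters" for w
      using that by (auto elim!: words_letters)
    then show ?thesis using realise_adj[OF that(3), of "- g"] that by simp
  qed
  moreover have "realise g [] = []" using realise_enc[of g "[]"] by simp
  ultimately show ?thesis
    using realise_Bij realise_adj by (auto simp: Aut_tree_def tree_auts_def)
qed

lemma realise_mult: "realise g \<otimes>\<^bsub>Aut_tree letters\<^esub> realise h = realise (g + h)"
  by (simp add: Aut_tree_def BijGroup_def realise_Bij compose_realise)

lemma realise_one: "\<one>\<^bsub>Aut_tree letters\<^esub> = realise 0"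
  by (simp add: Aut_tree_def BijGroup_def realise_zero)

interpretation A: group "Aut_tree letters"
  by (rule group_Aut_tree)

lemma realise_inv: "inv\<^bsub>Aut_tree letters\<^esub> (realise g) = realise (- g)"
  by (rule A.inv_equality) (simp_all add: realise_mult realise_one realise_carrier)

lemma realise_subgroup: "is_subgroup S \<Longrightarrow> subgroup (realise ` S) (Aut_tree letters)"
  by (rule A.subgroupI)
    (use is_subgroupD[of S] in \<open>auto simp: realise_carrier realise_inv realise_mult\<close>)

lemma realise_preimage: "subgroup M (Aut_tree letters) \<Longrightarrow> is_subgroup (realise -` M)"
  by (rule is_subgroupI)
    (auto simp flip: realise_one realise_mult realise_inv intro: subgroup.one_closed subgroup.m_closed subgroup.m_inv_closed)

definition wreath_aut :: "(nat list \<Rightarrow> nat list) set" where "wreath_aut = realise ` GGS_wreath"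

abbreviation wreath_rec where "wreath_rec \<equiv> Aut_tree letters\<lparr>carrier := wreath_aut\<rparr>"

lemma wreath_aut_subgroup: "subgroup wreath_aut (Aut_tree letters)"
  unfolding wreath_aut_def by (rule realise_subgroup[OF wreath_subgroup])

interpretation G: group wreath_rec
  by (rule A.subgroup_imp_group[OF wreath_aut_subgroup])

lemma finite_index_level:
  assumes M: "subgroup M (Aut_tree letters)" "M \<subseteq> wreath_aut" and MK: "realise ` level_comm (Suc n) \<subseteq> M"
  shows "finite_index M wreath_rec"
proof -
  have MG: "subgroup M wreath_rec" by (rule A.subgroup_incl[OF M(1) wreath_aut_subgroup M(2)])
  obtain F where F: "finite F" "\<And>g. g \<in> GGS_wreath \<Longrightarrow> \<exists>f\<in>F. g - f \<in> level_comm (Suc n)"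
    using finite_cover_wreath[of n] by auto
  have "rcosets\<^bsub>wreath_rec\<^esub> M \<subseteq> (\<lambda>f. M #>\<^bsub>wreath_rec\<^esub> realise f) ` F"
  proof
    fix C assume "C \<in> rcosets\<^bsub>wreath_rec\<^esub> M"
    then obtain g where g: "g \<in> GGS_wreath" "C = M #>\<^bsub>wreath_rec\<^esub> realise g"
      by (auto simp: RCOSETS_def wreath_aut_def)
    obtain f where f: "f \<in> F" "g - f \<in> level_comm (Suc n)" using F(2)[OF g(1)] by blast
    have "g - f \<in> GGS_wreath" using f(2) level_Suc_subset_wreath by blast
    then have "- (g - f) + g \<in> GGS_wreath" using GGS_wreath_closed g(1) by blast
    then have fW: "f \<in> GGS_wreath" by (simp only: group_word)
    have "realise (g - f) \<in> M" using MK f(2) by blast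
    moreover have "realise g = realise (g - f) \<otimes>\<^bsub>wreath_rec\<^esub> realise f" by (simp add: realise_mult)
    ultimately have "realise g \<in> M #>\<^bsub>wreath_rec\<^esub> realise f" unfolding r_coset_def by blast
    then have "M #>\<^bsub>wreath_rec\<^esub> realise f = M #>\<^bsub>wreath_rec\<^esub> realise g"
      by (rule G.repr_independence[OF _ _ MG]) (simp add: wreath_aut_def fW)
    then show "C \<in> (\<lambda>f. M #>\<^bsub>wreath_rec\<^esub> realise f) ` F" using f(1) g(2) by blast
  qed
  then show ?thesis using MG F(1) finite_subset unfolding finite_index_def by blast
qed

text \<open>Otherwise \<open>M\<close> together with any layer product generates the whole group by maximality, so \<open>M\<close> is dense.\<close>
lemma maximal_contains_level:
  assumes M: "maximal_subgroup M wreath_rec"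
  shows "\<exists>n. realise ` level_comm (Suc n) \<subseteq> M"
proof (rule ccontr)
  assume no_level: "\<not> ?thesis"
  have MG: "subgroup M wreath_rec" "M \<noteq> wreath_aut" using M by (auto simp: maximal_subgroup_def)
  have max: "J = M \<or> J = wreath_aut" if "subgroup J wreath_rec" "M \<subseteq> J" for J
    using M that by (auto simp: maximal_subgroup_def)
  have MA: "subgroup M (Aut_tree letters)" by (rule A.incl_subgroup[OF wreath_aut_subgroup MG(1)])
  have MsG: "M \<subseteq> wreath_aut" using subgroup.subset[OF MG(1)] by simp
  define H where "H = realise -` M"
  have H: "is_subgroup H" unfolding H_def by (rule realise_preimage[OF MA])
  note HD = is_subgroupD[OF H]
  have HW: "H \<subseteq> GGS_wreath" using MsG by (auto simp: H_def wreath_aut_def)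
  have MH: "M = realise ` H" using MsG by (auto simp: H_def wreath_aut_def)
  have "dense_in H GGS_wreath"
    unfolding dense_in_def
  proof (intro allI)
    fix n
    let ?S = "{h + k | h k. h \<in> H \<and> k \<in> level_comm (Suc n)}"
    have SI: "h + k \<in> ?S" if "h \<in> H" "k \<in> level_comm (Suc n)" for h k using that by blast
    have S: "is_subgroup ?S"
    proof (rule is_subgroupI)
      show "0 \<in> ?S" using SI[OF HD(1) level_closed(1)] by simp
      show "a + b \<in> ?S" if ab: "a \<in> ?S" "b \<in> ?S" for a b
      proof -
        obtain h k where hk: "h \<in> H" "k \<in> level_comm (Suc n)" "a = h + k" using ab(1) by blast
        obtain h' k' where hk': "h' \<in> H" "k' \<in> level_comm (Suc n)" "b = h' + k'" using ab(2) by blast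
        have "- h' + k - - h' \<in> level_comm (Suc n)"
          by (rule normalised_byD[OF level_Suc_normal]) (use hk' hk HW GGS_wreath_closed in auto)
        then have "(h + h') + ((- h' + k - - h') + k') \<in> ?S"
          using SI[OF HD(2)[OF hk(1) hk'(1)] level_closed(2)[OF _ hk'(2)]] by simp
        moreover have "(h + h') + ((- h' + k - - h') + k') = a + b"
          unfolding hk(3) hk'(3) by (simp only: group_word)
        ultimately show ?thesis by simp
      qed
      show "- a \<in> ?S" if a: "a \<in> ?S" for a
      proof -
        obtain h k where hk: "h \<in> H" "k \<in> level_comm (Suc n)" "a = h + k" using a by blast
        have "h + - k - h \<in> level_comm (Suc n)"
          by (rule normalised_byD[OF level_Suc_normal subsetD[OF HW hk(1)] level_closed(3)[OF hk(2)]])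
        then have "- h + (h + - k - h) \<in> ?S" using SI[OF HD(3)[OF hk(1)]] by simp
        moreover have "- h + (h + - k - h) = - a" unfolding hk(3) by (simp only: group_word)
        ultimately show ?thesis by simp
      qed
    qed
    have SW: "?S \<subseteq> GGS_wreath" using HW level_Suc_subset_wreath GGS_wreath_closed(2) by blast
    have HS: "H \<subseteq> ?S" using SI[OF _ level_closed(1)] by force
    have KS: "level_comm (Suc n) \<subseteq> ?S" using SI[OF HD(1)] by force
    have sub: "subgroup (realise ` ?S) wreath_rec"
      by (rule A.subgroup_incl[OF realise_subgroup[OF S] wreath_aut_subgroup])
        (unfold wreath_aut_def, rule image_mono[OF SW])
    have "M \<subseteq> realise ` ?S" unfolding MH by (rule image_mono[OF HS])
    then have "realise ` ?S = M \<or> realise ` ?S = wreath_aut" by (rule max[OF sub])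
    moreover have "realise ` ?S \<noteq> M"
    proof
      assume "realise ` ?S = M"
      then have "realise ` level_comm (Suc n) \<subseteq> M" using image_mono[OF KS, of realise] by simp
      then show False using no_level by blast
    qed
    ultimately have "realise ` ?S = realise ` GGS_wreath" by (simp add: wreath_aut_def)
    then have "?S = GGS_wreath" using inj_image_eq_iff[of realise ?S GGS_wreath] by (simp add: inj_def)
    then show "\<forall>g\<in>GGS_wreath. \<exists>h\<in>H. \<exists>k\<in>level_comm (Suc n). g = h + k" by blast
  qed
  then have "H = GGS_wreath" using dense_in_wreath_eq H HW by blast
  then show False using MG(2) MH by (simp add: wreath_aut_def)
qed

lemma in_MF_wreath_aut: "in_MF wreath_rec"
  unfolding in_MF_def
proof (intro conjI allI impI)
  show "group wreath_rec" by (rule G.is_group)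
  fix M assume M: "maximal_subgroup M wreath_rec"
  then have MG: "subgroup M wreath_rec" by (simp add: maximal_subgroup_def)
  obtain n where "realise ` level_comm (Suc n) \<subseteq> M" using maximal_contains_level[OF M] by blast
  then show "finite_index M wreath_rec"
    by (rule finite_index_level[rotated 2])
      (use A.incl_subgroup[OF wreath_aut_subgroup MG] subgroup.subset[OF MG] in auto)
qed

text \<open>The rigid stabilisers of layer \<open>n\<close> contain the copies of \<open>GGS_comm\<close> one layer further down.\<close>
lemma branch_wreath_aut: "branch_group letters wreath_aut"
  unfolding branch_group_def
proof (intro conjI allI)
  show "subgroup wreath_aut (Aut_tree letters)" by (rule wreath_aut_subgroup)
  show "spherically_transitive letters wreath_aut"
    unfolding spherically_transitive_def
  proof (intro allI ballI)
    fix n u v assume u: "u \<in> layer letters n" and v: "v \<in> layer letters n"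
    then obtain u' v' where uv: "u = map enc u'" "v = map enc v'" "length u' = length v'"
      unfolding layer_def by (auto elim!: words_letters)
    then obtain g where "g \<in> GGS" "act g u' = v'" using GGS_transitive by blast
    then show "\<exists>g\<in>wreath_aut. g u = v" using uv GGS_subset_wreath by (intro bexI[of _ "realise g"]) (auto simp: wreath_aut_def)
  qed
  fix n
  have ristA: "rist letters wreath_aut v \<subseteq> wreath_aut" for v by (auto simp: rist_def)
  then have UG: "(\<Union>v\<in>layer letters n. rist letters wreath_aut v) \<subseteq> wreath_aut" by blast
  then have UA: "(\<Union>v\<in>layer letters n. rist letters wreath_aut v) \<subseteq> carrier (Aut_tree letters)"
    using subgroup.subset[OF wreath_aut_subgroup] by blast
  have S: "subgroup (Rist letters wreath_aut n) (Aut_tree letters)"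
    unfolding Rist_def by (rule A.generate_is_subgroup[OF UA])
  have SG: "Rist letters wreath_aut n \<subseteq> wreath_aut"
    unfolding Rist_def by (rule A.generate_subgroup_incl[OF UG wreath_aut_subgroup])
  have at: "realise (at_vertex w k) \<in> Rist letters wreath_aut n" if w: "length w = Suc n" and k: "k \<in> GGS_comm" for w k
  proof -
    let ?v = "take n w"
    have vl: "map enc ?v \<in> layer letters n" unfolding layer_def using w map_enc_letters[of ?v] by simp
    have wv: "w = ?v @ drop n w" by simp
    have "realise (at_vertex w k) u = u" if u: "u \<in> lists letters - subtree letters (map enc ?v)" for u
    proof -
      obtain u' where u': "u = map enc u'" using u words_letters by blast
      have "u' \<noteq> ?v @ r" for r
      proof
        assume "u' = ?v @ r"
        then have "u = map enc ?v @ map enc r" unfolding u' by (metis map_append)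
        then have "u \<in> subtree letters (map enc ?v)" unfolding subtree_def using map_enc_letters by blast
        then show False using u by simp
      qed
      then have "act (at_vertex ?v (at_vertex (drop n w) k)) u' = u'" by (rule act_vertex_outside)
      then show ?thesis unfolding u' realise_enc using wv by (simp flip: vertex_append)
    qed
    moreover have "realise (at_vertex w k) \<in> wreath_aut" using comm_vertex[OF k] comm_subset_GGS GGS_subset_wreath by (auto simp: wreath_aut_def)
    ultimately have "realise (at_vertex w k) \<in> rist letters wreath_aut (map enc ?v)" by (simp add: rist_def)
    then show ?thesis unfolding Rist_def using vl by (intro generate.incl) blast
  qed
  have "level_comm (Suc n) \<subseteq> realise -` Rist letters wreath_aut n"
    by (rule level_least[OF realise_preimage[OF S]]) (simp add: at)
  then show "finite_index (Rist letters wreath_aut n) wreath_rec"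
    by (intro finite_index_level[OF S SG]) blast
qed

text \<open>Generators are the permutations of the seven subtrees and the generators of \<open>GGS\<close> placed below the letters.\<close>
lemma finitely_generated_wreath_aut: "finitely_generated wreath_rec"
proof -
  define B where "B = {node s (\<lambda>_. 0) | s. bij s} \<union> (\<Union>x. \<Union>c. {at_vertex [x] (rot c), at_vertex [x] (dir c)})"
  have fin: "finite B" unfolding B_def by (intro finite_UnI finite_UN_I) (auto intro: finite_subset[OF _ finite_imageI[of UNIV "\<lambda>s. node s (\<lambda>_. 0)"]])
  have BW: "B \<subseteq> GGS_wreath"
    unfolding B_def using GGS_closed(1) by (auto simp: GGS_wreath_def sec_node)
  let ?S = "generate wreath_rec (realise ` B)"
  have BG: "realise ` B \<subseteq> carrier wreath_rec" using image_mono[OF BW, of realise] by (simp add: wreath_aut_def)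
  have S: "subgroup ?S wreath_rec" by (rule G.generate_is_subgroup[OF BG])
  have SA: "subgroup ?S (Aut_tree letters)" by (rule A.incl_subgroup[OF wreath_aut_subgroup S])
  define P where "P = realise -` ?S"
  have P: "is_subgroup P" unfolding P_def by (rule realise_preimage[OF SA])
  note PD = is_subgroupD[OF P]
  have BP: "b \<in> P" if "b \<in> B" for b unfolding P_def using that by (simp add: generate.incl)
  have gens: "at_vertex [x] (rot c) \<in> B" "at_vertex [x] (dir c) \<in> B" for x c
    unfolding B_def by blast+
  have LP: "at_vertex [x] l \<in> P" if "l \<in> GGS" for x l
  proof -
    have "l \<in> {l. at_vertex [x] l \<in> P}"
    proof (rule GGS_induct[OF that])
      show "is_subgroup {l. at_vertex [x] l \<in> P}"
        by (rule is_subgroupI) (auto simp: PD vertex_plus vertex_uminus)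
    qed (simp_all add: BP gens)
    then show ?thesis by simp
  qed
  have "GGS_wreath \<subseteq> P"
  proof
    fix g assume g: "g \<in> GGS_wreath"
    obtain s where s: "\<And>x. act g [x] = [s x]" using act_single[of g] by metis
    have "inj s"
    proof (rule injI)
      fix x y assume "s x = s y"
      then have "act g [x] = act g [y]" by (simp add: s)
      then show "x = y" by simp
    qed
    then have bs: "bij s" by (simp add: bij_def finite_UNIV_inj_surj)
    let ?n = "node s (\<lambda>_. 0)"
    have nP: "?n \<in> P" by (rule BP) (use bs B_def in blast)
    have fx: "act (- ?n + g) [x] = [x]" for x
      using bs s[of x] by (simp add: act_uminus_iff act_node)
    have "- ?n + g \<in> P"
    proof (rule subgroup_contains_parts[OF P fx])
      fix x
      have "act (- ?n) [s x] = [x]" using bs by (simp add: act_uminus_iff act_node)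
      then have "sec (- ?n + g) [x] = sec g [x]"
        using bs by (simp add: s sec_uminus sec_node)
      then show "at_vertex [x] (sec (- ?n + g) [x]) \<in> P" using LP g by (simp add: GGS_wreath_def)
    qed
    then have "?n + (- ?n + g) \<in> P" using PD(2) nP by blast
    then show "g \<in> P" by (simp only: group_word)
  qed
  then have "wreath_aut \<subseteq> ?S" by (auto simp: wreath_aut_def P_def)
  then have "?S = carrier wreath_rec" using subgroup.subset[OF S] by auto
  then show ?thesis unfolding finitely_generated_def using G.is_group fin BG by blast
qed

definition top_perm :: "(nat list \<Rightarrow> nat list) \<Rightarrow> nat \<Rightarrow> nat" where
  "top_perm f = (\<lambda>n. if n \<in> letters then hd (f [n]) else n)"

lemma top_perm_realise: "act g [x] = [y] \<Longrightarrow> top_perm (realise g) (enc x) = enc y"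
  using realise_enc[of g "[x]"] by (simp add: top_perm_def del: realise_enc)

lemma top_perm_outside: "n \<notin> letters \<Longrightarrow> top_perm f n = n"
  by (simp add: top_perm_def)

lemma letters_cases: assumes "n \<in> letters" obtains x where "n = enc x"
  using enc_dec[OF assms] by metis

lemma top_perm_mult: "top_perm (realise (g + h)) = top_perm (realise g) \<circ> top_perm (realise h)"
proof
  fix n
  show "top_perm (realise (g + h)) n = (top_perm (realise g) \<circ> top_perm (realise h)) n"
  proof (cases "n \<in> letters")
    case True
    then obtain x where n: "n = enc x" by (rule letters_cases)
    obtain y where y: "act h [x] = [y]" using act_single[of h x] by blast
    obtain z where z: "act g [y] = [z]" using act_single[of g y] by blast
    have "act (g + h) [x] = [z]" by (simp add: y z)
    then show ?thesis unfolding n comp_apply top_perm_realise[OF y] top_perm_realise[OF z]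
      by (rule top_perm_realise)
  qed (simp add: top_perm_outside)
qed

lemma top_perm_zero: "top_perm (realise 0) = id"
proof
  fix n
  show "top_perm (realise 0) n = id n"
  proof (cases "n \<in> letters")
    case True
    then obtain x where n: "n = enc x" by (rule letters_cases)
    show ?thesis unfolding n by (subst top_perm_realise[of 0 x x]) simp_all
  qed (simp add: top_perm_outside)
qed

lemma top_perm_permutes: "top_perm (realise g) permutes letters"
proof -
  have "top_perm (realise g) \<circ> top_perm (realise (- g)) = id" "top_perm (realise (- g)) \<circ> top_perm (realise g) = id"
    by (simp_all flip: top_perm_mult add: top_perm_zero)
  then have "bij (top_perm (realise g))" by (rule o_bij[rotated])
  then show ?thesis using top_perm_outside by (auto simp: permutes_def bij_iff)
qed

lemma top_perm_surj:
  assumes p: "p permutes letters" shows "\<exists>g\<in>GGS_wreath. top_perm (realise g) = p"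
proof
  define s where "s x = dec (p (enc x))" for x
  have ps: "enc (s x) = p (enc x)" for x
    unfolding s_def by (rule enc_dec) (simp add: permutes_in_image[OF p])
  have "inj s"
  proof (rule injI)
    fix x y assume "s x = s y"
    then have "p (enc x) = p (enc y)" by (metis ps)
    then show "x = y" using permutes_inj[OF p] by (simp add: inj_eq)
  qed
  then have bs: "bij s" by (simp add: bij_def finite_UNIV_inj_surj)
  let ?g = "node s (\<lambda>_. 0)"
  show "?g \<in> GGS_wreath" using bs GGS_closed(1) by (simp add: GGS_wreath_def sec_node)
  show "top_perm (realise ?g) = p"
  proof
    fix n
    show "top_perm (realise ?g) n = p n"
    proof (cases "n \<in> letters")
      case True
      then obtain x where n: "n = enc x" by (rule letters_cases)
      have "act ?g [x] = [s x]" using bs by (simp add: act_node)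
      then show ?thesis unfolding n ps[symmetric] by (rule top_perm_realise)
    next
      case False
      then show ?thesis using permutes_not_in[OF p] by (simp add: top_perm_outside)
    qed
  qed
qed

text \<open>The action on the first layer is a homomorphism onto \<open>Sym(7)\<close> whose kernel contains a rotation placed below the
letter 0.\<close>
lemma not_just_insoluble_wreath_aut: "\<not> just_insoluble wreath_rec"
proof
  assume ji: "just_insoluble wreath_rec"
  have hom: "top_perm \<in> hom wreath_rec (sym_group 7)"
  proof -
    have "top_perm (realise g) \<in> carrier (sym_group 7)" for g
      using top_perm_permutes[of g] by (simp add: sym_group_def letters_def)
    then show ?thesis by (auto simp: hom_def wreath_aut_def sym_group_mult realise_mult top_perm_mult)
  qed
  interpret h: group_hom wreath_rec "sym_group 7" top_perm
    using hom sym_group_is_group G.is_group by (simp add: group_hom_def group_hom_axioms_def)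
  have surj: "top_perm ` carrier wreath_rec = carrier (sym_group 7)"
  proof
    show "top_perm ` carrier wreath_rec \<subseteq> carrier (sym_group 7)" using h.hom_closed by blast
    show "carrier (sym_group 7) \<subseteq> top_perm ` carrier wreath_rec"
    proof
      fix p assume "p \<in> carrier (sym_group 7)"
      then have "p permutes letters" by (simp add: sym_group_def letters_def)
      then obtain g where "g \<in> GGS_wreath" "top_perm (realise g) = p" using top_perm_surj by blast
      then show "p \<in> top_perm ` carrier wreath_rec" by (auto simp: wreath_aut_def)
    qed
  qed
  let ?N = "kernel wreath_rec (sym_group 7) top_perm"
  let ?g = "at_vertex [0] (rot 1)"
  have gW: "?g \<in> GGS_wreath" using GGS_closed(1) by (simp add: GGS_wreath_def)
  have "top_perm (realise ?g) = id"
  proof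
    fix n
    show "top_perm (realise ?g) n = id n"
    proof (cases "n \<in> letters")
      case True
      then obtain x where n: "n = enc x" by (rule letters_cases)
      show ?thesis unfolding n by (subst top_perm_realise[of ?g x x]) simp_all
    qed (simp add: top_perm_outside)
  qed
  then have gN: "realise ?g \<in> ?N" using gW by (simp add: kernel_def wreath_aut_def sym_group_def)
  have "?g \<noteq> 0"
  proof
    assume "?g = 0"
    then have "rot 1 = 0" using sec_vertex_self[of "[0]" "rot 1"] by simp
    then have "root_shift (rot 1) = root_shift 0" by (rule arg_cong)
    then show False by simp
  qed
  then have "realise ?g \<noteq> \<one>\<^bsub>wreath_rec\<^esub>" by (simp add: realise_one)
  then have "?N \<noteq> {\<one>\<^bsub>wreath_rec\<^esub>}" using gN by blast
  then have sol: "solvable (wreath_rec Mod ?N)" using ji h.normal_kernel unfolding just_insoluble_def by blast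
  have iso: "(\<lambda>X. the_elem (top_perm ` X)) \<in> iso (wreath_rec Mod ?N) (sym_group 7)"
    by (rule h.FactGroup_iso_set[OF surj])
  interpret q: group_hom "wreath_rec Mod ?N" "sym_group 7" "\<lambda>X. the_elem (top_perm ` X)"
    using iso sym_group_is_group normal.factorgroup_is_group[OF h.normal_kernel]
    by (simp add: group_hom_def group_hom_axioms_def iso_def)
  have "solvable (sym_group 7)"
    by (rule q.surj_hom_imp_solvable[OF _ sol]) (use iso in \<open>simp add: iso_def bij_betw_def\<close>)
  then show False using sym_group_is_unsolvable[of 7] by simp
qed

theorem mainTheorem2:
  shows "\<exists>(X :: nat set) G.
           finite X \<and> card X \<ge> 2 \<and>
           branch_group X G \<and>
           finitely_generated (Aut_tree X\<lparr>carrier := G\<rparr>) \<and>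
           in_MF (Aut_tree X\<lparr>carrier := G\<rparr>) \<and>
           \<not> just_insoluble (Aut_tree X\<lparr>carrier := G\<rparr>)"
proof (intro exI conjI)
  show "finite letters" "card letters \<ge> 2" by (simp_all add: letters_def)
qed (rule branch_wreath_aut finitely_generated_wreath_aut in_MF_wreath_aut not_just_insoluble_wreath_aut)+

end
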